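(* Let $\mu$ be a probability measure on $\mathbb{R}$ with mean $\alpha$ and variance $\beta>0$, and let $\nu=\mathcal{J}[\mu]$. Then $L_\mu$ is a (non-zero scalar) multiple of a unitary operator $$\{f\in L^2(\mu):\mu[f]=0\}\to L^2(\nu),$$ and its inverse is $x-\alpha-\beta L_\nu$.
   Context: $G_\mu(z)=\int_{\mathbb{R}}\frac{1}{z-x}\,d\mu(x)$ for $z\in\mathbb{C}\setminus\mathbb{R}$, $F_\mu=1/G_\mu$, and $\mu[f]=\int f\,d\mu$. For $\mu$ with mean $\alpha$ and variance $\beta>0$, $\mathcal{J}[\mu]$ is the unique probability measure such that $F_\mu(z)=z-\alpha-\beta G_{\mathcal{J}[\mu]}(z)$. For a finite measure $\nu$, $L_\nu f(x)=\int_{\mathbb{R}}\frac{f(x)-f(y)}{x-y}\,d\nu(y)$. In particular $L_\nu$ kills constants and $L_\nu\left[\frac{1}{z-x}\right]=\frac{G_\nu(z)}{z-x}$. The operators are understood on the $L^2$ spaces as the continuous extensions from resolvents: let $\widetilde{\mathcal{D}}=\mathrm{Span}\{\frac{1}{z-x}:z\in\mathbb{C}\setminus\mathbb{R}\}$ (dense in both $L^2(\mu)$ and $L^2(\nu)$). $L_\mu$ is the continuous extension of its restriction to the functions $f-\mu[f]$, $f\in\widetilde{\mathcal{D}}$ (which are dense in $\{f\in L^2(\mu):\mu[f]=0\}$), and $x-\alpha-\beta L_\nu$, where $x$ denotes multiplication by the independent variable, is the continuous extension to $L^2(\nu)$ of the operator $f\mapsto (x-\alpha)f-\beta L_\nu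 f$ on $\widetilde{\mathcal{D}}$. *)

theory Defs
  imports "HOL-Probability.Probability"
begin

definition cauchy_transform :: "real measure \<Rightarrow> complex \<Rightarrow> complex" where
  "cauchy_transform M z = (\<integral>x. 1 / (z - complex_of_real x) \<partial>M)"

definition F_transform :: "real measure \<Rightarrow> complex \<Rightarrow> complex" where
  "F_transform M z = 1 / cauchy_transform M z"

definition mean :: "real measure \<Rightarrow> real" where
  "mean M = (\<integral>x. x \<partial>M)"

definition var :: "real measure \<Rightarrow> real" where
  "var M = (\<integral>x. (x - mean M)\<^sup>2 \<partial>M)"

text \<open>\<open>is_J M N\<close> says that \<open>N\<close> is the measure \<open>\<J>[M]\<close>, through the property that determines it.\<close>

definition is_J :: "real measure \<Rightarrow> real measure \<Rightarrow> bool" where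
  "is_J M N \<longleftrightarrow> real_distribution N \<and>
     (\<forall>z. z \<notin> \<real> \<longrightarrow> F_transform M z =
        z - complex_of_real (mean M) - complex_of_real (var M) * cauchy_transform N z)"

definition square_integrable :: "real measure \<Rightarrow> (real \<Rightarrow> complex) set" where
  "square_integrable M = {f \<in> borel_measurable M. integrable M (\<lambda>x. (cmod (f x))\<^sup>2)}"

definition ae_eq :: "real measure \<Rightarrow> ((real \<Rightarrow> complex) \<times> (real \<Rightarrow> complex)) set" where
  "ae_eq M = {(f, g). f \<in> square_integrable M \<and> g \<in> square_integrable M \<and> (AE x in M. f x = g x)}"

definition L2 :: "real measure \<Rightarrow> (real \<Rightarrow> complex) set set" where
  "L2 M = square_integrable M // ae_eq M"

definition L2_class :: "real measure \<Rightarrow> (real \<Rightarrow> complex) \<Rightarrow> (real \<Rightarrow> complex) set" where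
  "L2_class M f = ae_eq M `` {f}"

definition L2_rep :: "(real \<Rightarrow> complex) set \<Rightarrow> real \<Rightarrow> complex" where
  "L2_rep F = (SOME f. f \<in> F)"

definition L2_add :: "real measure \<Rightarrow> (real \<Rightarrow> complex) set \<Rightarrow> (real \<Rightarrow> complex) set \<Rightarrow> (real \<Rightarrow> complex) set" where
  "L2_add M F G = L2_class M (\<lambda>x. L2_rep F x + L2_rep G x)"

definition L2_scale :: "real measure \<Rightarrow> complex \<Rightarrow> (real \<Rightarrow> complex) set \<Rightarrow> (real \<Rightarrow> complex) set" where
  "L2_scale M c F = L2_class M (\<lambda>x. c * L2_rep F x)"

definition L2_inner :: "real measure \<Rightarrow> (real \<Rightarrow> complex) set \<Rightarrow> (real \<Rightarrow> complex) set \<Rightarrow> complex" where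
  "L2_inner M F G = (\<integral>x. L2_rep F x * cnj (L2_rep G x) \<partial>M)"

definition L2_dist :: "real measure \<Rightarrow> (real \<Rightarrow> complex) set \<Rightarrow> (real \<Rightarrow> complex) set \<Rightarrow> real" where
  "L2_dist M F G = sqrt (\<integral>x. (cmod (L2_rep F x - L2_rep G x))\<^sup>2 \<partial>M)"

definition L2_topology :: "real measure \<Rightarrow> (real \<Rightarrow> complex) set topology" where
  "L2_topology M = Metric_space.mtopology (L2 M) (L2_dist M)"

definition L2_zero_mean :: "real measure \<Rightarrow> (real \<Rightarrow> complex) set set" where
  "L2_zero_mean M = {F \<in> L2 M. (\<integral>x. L2_rep F x \<partial>M) = 0}"

definition is_unitary ::
  "real measure \<Rightarrow> (real \<Rightarrow> complex) set set \<Rightarrow> real measure \<Rightarrow> (real \<Rightarrow> complex) set set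
    \<Rightarrow> ((real \<Rightarrow> complex) set \<Rightarrow> (real \<Rightarrow> complex) set) \<Rightarrow> bool" where
  "is_unitary M X N Y U \<longleftrightarrow> bij_betw U X Y \<and>
     (\<forall>F\<in>X. \<forall>G\<in>X. U (L2_add M F G) = L2_add N (U F) (U G)) \<and>
     (\<forall>c. \<forall>F\<in>X. U (L2_scale M c F) = L2_scale N c (U F)) \<and>
     (\<forall>F\<in>X. \<forall>G\<in>X. L2_inner N (U F) (U G) = L2_inner M F G)"

definition is_multiple_of_unitary ::
  "real measure \<Rightarrow> (real \<Rightarrow> complex) set set \<Rightarrow> real measure \<Rightarrow> (real \<Rightarrow> complex) set set
    \<Rightarrow> ((real \<Rightarrow> complex) set \<Rightarrow> (real \<Rightarrow> complex) set) \<Rightarrow> bool" where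
  "is_multiple_of_unitary M X N Y T \<longleftrightarrow>
     (\<exists>c U. c \<noteq> 0 \<and> is_unitary M X N Y U \<and> (\<forall>F\<in>X. T F = L2_scale N c (U F)))"

text \<open>The densely defined operator is given by its graph \<open>R\<close>, since an operator defined by a formula on
  functions need not be single-valued on classes a priori; the existence of \<open>T\<close> forces it to be.\<close>

definition is_continuous_extension ::
  "'a topology \<Rightarrow> 'b topology \<Rightarrow> ('a \<times> 'b) set \<Rightarrow> ('a \<Rightarrow> 'b) \<Rightarrow> bool" where
  "is_continuous_extension X Y R T \<longleftrightarrow>
     T \<in> extensional (topspace X) \<and> continuous_map X Y T \<and> (\<forall>(F, G)\<in>R. T F = G)"

definition continuous_extension ::
  "'a topology \<Rightarrow> 'b topology \<Rightarrow> ('a \<times> 'b) set \<Rightarrow> 'a \<Rightarrow> 'b" where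
  "continuous_extension X Y R = (THE T. is_continuous_extension X Y R T)"

definition resolvent_span :: "(real \<Rightarrow> complex) set" where
  "resolvent_span =
     {\<lambda>x. \<Sum>z\<in>A. c z * (1 / (z - complex_of_real x)) | A c. finite A \<and> A \<inter> \<real> = {}}"

text \<open>The difference quotient takes its limit value on the diagonal. Otherwise the diagonal would
  contribute \<open>0\<close> at atoms of \<open>M\<close>, and the identity \<open>L\<^sub>M [1/(z-x)] = G\<^sub>M(z)/(z-x)\<close>
  would fail there.\<close>

definition diff_quotient :: "(real \<Rightarrow> complex) \<Rightarrow> real \<Rightarrow> real \<Rightarrow> complex" where
  "diff_quotient f x y =
     (if x = y then vector_derivative f (at x) else (f x - f y) / complex_of_real (x - y))"

definition L_fun :: "real measure \<Rightarrow> (real \<Rightarrow> complex) \<Rightarrow> real \<Rightarrow> complex" where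
  "L_fun M f x = (\<integral>y. diff_quotient f x y \<partial>M)"

definition centred :: "real measure \<Rightarrow> (real \<Rightarrow> complex) \<Rightarrow> real \<Rightarrow> complex" where
  "centred M f = (\<lambda>x. f x - (\<integral>y. f y \<partial>M))"

definition L_graph :: "real measure \<Rightarrow> real measure \<Rightarrow> ((real \<Rightarrow> complex) set \<times> (real \<Rightarrow> complex) set) set" where
  "L_graph M N = {(L2_class M (centred M f), L2_class N (L_fun M (centred M f))) | f. f \<in> resolvent_span}"

definition L_op :: "real measure \<Rightarrow> real measure \<Rightarrow> (real \<Rightarrow> complex) set \<Rightarrow> (real \<Rightarrow> complex) set" where
  "L_op M N = continuous_extension (subtopology (L2_topology M) (L2_zero_mean M)) (L2_topology N) (L_graph M N)"

text \<open>The operator \<open>x - a - b L\<^sub>N\<close>: it is defined on (classes in) \<open>L\<^sup>2(N)\<close>, while its values are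
  read as elements of \<open>L\<^sup>2(M)\<close>.\<close>

definition K_graph ::
  "real measure \<Rightarrow> real measure \<Rightarrow> real \<Rightarrow> real \<Rightarrow> ((real \<Rightarrow> complex) set \<times> (real \<Rightarrow> complex) set) set" where
  "K_graph M N a b =
     {(L2_class N f,
       L2_class M (\<lambda>x. complex_of_real (x - a) * f x - complex_of_real b * L_fun N f x))
      | f. f \<in> resolvent_span}"

definition K_op ::
  "real measure \<Rightarrow> real measure \<Rightarrow> real \<Rightarrow> real \<Rightarrow> (real \<Rightarrow> complex) set \<Rightarrow> (real \<Rightarrow> complex) set" where
  "K_op M N a b = continuous_extension (L2_topology N) (L2_topology M) (K_graph M N a b)"

end

theory Submission
  imports Defs
begin

text \<open>
  Write \<open>e\<^sub>z(x) = 1/(z-x)\<close>, and let \<open>G\<close> and \<open>F = 1/G\<close> be the transforms of \<open>\<mu>\<close>. The proof rests on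
  two identities between resolvents and one between their inner products.

  On resolvents both operators act by a scalar, up to centring:
  \<open>L\<^sub>\<mu> (e\<^sub>z - G(z)) = G(z) e\<^sub>z\<close>, because the difference quotient of \<open>e\<^sub>z\<close> factors as
  \<open>e\<^sub>z(x) e\<^sub>z(y)\<close>, and \<open>(x - \<alpha> - \<beta> L\<^sub>\<nu>) e\<^sub>z = F(z) (e\<^sub>z - G(z))\<close>, because the factor
  \<open>x - \<alpha> - \<beta> G\<^sub>\<nu>(z)\<close> equals \<open>F(z) - (z - x)\<close> by the equation that defines \<open>\<nu> = \<J>[\<mu>]\<close>. Since
  \<open>F G = 1\<close>, the two operators are inverse to each other on spans of resolvents
  (\<open>L_fun_resolvent_sum\<close>, \<open>K_fun_resolvent_sum\<close>).

  The conjugate of \<open>e\<^sub>w\<close> is the resolvent at the conjugate point, so every inner product of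
  resolvents is an integral of some \<open>e\<^sub>z e\<^sub>w\<close>, and by partial fractions it is
  \<open>(G(z) - G(w)) / (w - z)\<close>. Substituting \<open>\<beta> G\<^sub>\<nu>(z) = z - \<alpha> - 1/G(z)\<close> turns this formula for
  \<open>\<nu>\<close> into
  \<open>\<beta> G(z) G(w) \<integral> e\<^sub>z e\<^sub>w d\<nu> = \<integral> e\<^sub>z e\<^sub>w d\<mu> - G(z) G(w)\<close>
  (\<open>resolvent_kernel_identity\<close>). The right-hand side is the inner product of the centred
  resolvents, so \<open>\<surd>\<beta> L\<^sub>\<mu>\<close> preserves norms on their span.

  It remains to pass to the closure. Resolvents span a dense subspace of every \<open>L\<^sup>2\<close> of a
  probability measure (\<open>resolvent_span_dense\<close>) and these spaces are complete
  (\<open>L2_geometric_Cauchy_converges\<close>). Hence the closure of the graph of \<open>L\<^sub>\<mu>\<close> relates every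
  centred function of \<open>L\<^sup>2(\<mu>)\<close> to a function of \<open>L\<^sup>2(\<nu>)\<close> and conversely, uniquely up to null sets
  by the norm identity. Read from left to right this closed relation is the extension of
  \<open>L\<^sub>\<mu>\<close>, read from right to left it is the extension of \<open>x - \<alpha> - \<beta> L\<^sub>\<nu>\<close>, and the two maps are
  mutually inverse.
\<close>

section \<open>The Hilbert seminorm on square integrable functions\<close>

definition l2norm :: "real measure \<Rightarrow> (real \<Rightarrow> complex) \<Rightarrow> real" where
  "l2norm M f = sqrt (\<integral>x. (cmod (f x))\<^sup>2 \<partial>M)"

lemma square_integrable_measurable: "f \<in> square_integrable M \<Longrightarrow> f \<in> borel_measurable M"
  by (simp add: square_integrable_def)

lemma square_integrable_scale:
  assumes "f \<in> square_integrable M"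
  shows "(\<lambda>x. c * f x) \<in> square_integrable M"
  using assms by (auto simp: square_integrable_def norm_mult power_mult_distrib)

lemma square_integrable_add:
  assumes "f \<in> square_integrable M" "g \<in> square_integrable M"
  shows "(\<lambda>x. f x + g x) \<in> square_integrable M"
proof -
  have [measurable]: "f \<in> borel_measurable M" "g \<in> borel_measurable M"
    using assms by (auto simp: square_integrable_def)
  have "(cmod (f x + g x))\<^sup>2 \<le> 2 * (cmod (f x))\<^sup>2 + 2 * (cmod (g x))\<^sup>2" for x
  proof -
    have "(cmod (f x + g x))\<^sup>2 \<le> (cmod (f x) + cmod (g x))\<^sup>2"
      by (intro power_mono norm_triangle_ineq) simp
    also have "\<dots> \<le> 2 * (cmod (f x))\<^sup>2 + 2 * (cmod (g x))\<^sup>2"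
      using sum_squares_bound[of "cmod (f x)" "cmod (g x)"] by (simp add: power2_sum)
    finally show ?thesis .
  qed
  then have "AE x in M. norm ((cmod (f x + g x))\<^sup>2)
      \<le> norm (2 * (cmod (f x))\<^sup>2 + 2 * (cmod (g x))\<^sup>2)"
    by simp
  moreover have "integrable M (\<lambda>x. 2 * (cmod (f x))\<^sup>2 + 2 * (cmod (g x))\<^sup>2)"
    using assms by (simp add: square_integrable_def)
  ultimately have "integrable M (\<lambda>x. (cmod (f x + g x))\<^sup>2)"
    by (rule Bochner_Integration.integrable_bound[rotated 2]) simp
  then show ?thesis by (simp add: square_integrable_def)
qed

lemma square_integrable_diff:
  assumes "f \<in> square_integrable M" "g \<in> square_integrable M"
  shows "(\<lambda>x. f x - g x) \<in> square_integrable M"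
  using square_integrable_add[OF assms(1) square_integrable_scale[OF assms(2), of "-1"]] by simp

lemma l2norm_nonneg [simp]: "0 \<le> l2norm M f"
  by (simp add: l2norm_def)

lemma l2norm_power2: "(l2norm M f)\<^sup>2 = (\<integral>x. (cmod (f x))\<^sup>2 \<partial>M)"
  by (simp add: l2norm_def)

lemma l2norm_cong_AE:
  assumes "f \<in> borel_measurable M" "g \<in> borel_measurable M" "AE x in M. f x = g x"
  shows "l2norm M f = l2norm M g"
proof -
  note [measurable] = assms(1,2)
  show ?thesis
    unfolding l2norm_def using assms(3) by (intro arg_cong[where f = sqrt] integral_cong_AE) auto
qed

lemma l2norm_scale: "l2norm M (\<lambda>x. c * f x) = cmod c * l2norm M f"
  by (simp add: l2norm_def norm_mult power_mult_distrib real_sqrt_mult)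

lemma l2norm_minus_commute: "l2norm M (\<lambda>x. f x - g x) = l2norm M (\<lambda>x. g x - f x)"
  by (simp add: l2norm_def norm_minus_commute)

lemma l2norm_eq_0_iff:
  assumes "f \<in> square_integrable M"
  shows "l2norm M f = 0 \<longleftrightarrow> (AE x in M. f x = 0)"
  using assms integral_nonneg_eq_0_iff_AE[of M "\<lambda>x. (cmod (f x))\<^sup>2"]
  by (simp add: l2norm_def square_integrable_def)

lemma nn_integral_square:
  assumes "f \<in> square_integrable M"
  shows "(\<integral>\<^sup>+x. ennreal ((cmod (f x))\<^sup>2) \<partial>M) = ennreal ((l2norm M f)\<^sup>2)"
  using assms by (simp add: l2norm_power2 square_integrable_def nn_integral_eq_integral)

lemma Cauchy_Schwarz_l2norm:
  assumes f: "f \<in> square_integrable M" and g: "g \<in> square_integrable M"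
  shows "integrable M (\<lambda>x. cmod (f x) * cmod (g x))"
    and "(\<integral>x. cmod (f x) * cmod (g x) \<partial>M) \<le> l2norm M f * l2norm M g"
proof -
  have [measurable]: "f \<in> borel_measurable M" "g \<in> borel_measurable M"
    using assms by (auto simp: square_integrable_def)
  have "norm (cmod (f x) * cmod (g x)) \<le> norm ((cmod (f x))\<^sup>2 + (cmod (g x))\<^sup>2)" for x
  proof -
    have "0 \<le> cmod (f x) * cmod (g x)" by simp
    then have "cmod (f x) * cmod (g x) \<le> (cmod (f x))\<^sup>2 + (cmod (g x))\<^sup>2"
      using sum_squares_bound[of "cmod (f x)" "cmod (g x)"] by linarith
    then show ?thesis by simp
  qed
  then have "AE x in M. norm (cmod (f x) * cmod (g x)) \<le> norm ((cmod (f x))\<^sup>2 + (cmod (g x))\<^sup>2)"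
    by (rule AE_I2)
  moreover have "integrable M (\<lambda>x. (cmod (f x))\<^sup>2 + (cmod (g x))\<^sup>2)"
    using assms by (simp add: square_integrable_def)
  ultimately show int: "integrable M (\<lambda>x. cmod (f x) * cmod (g x))"
    by (rule Bochner_Integration.integrable_bound[rotated 2]) simp
  let ?I = "\<integral>x. cmod (f x) * cmod (g x) \<partial>M"
  have I: "0 \<le> ?I" by simp
  have "(\<integral>\<^sup>+x. ennreal (cmod (f x)) * ennreal (cmod (g x)) \<partial>M)\<^sup>2
      \<le> (\<integral>\<^sup>+x. (ennreal (cmod (f x)))\<^sup>2 \<partial>M) * (\<integral>\<^sup>+x. (ennreal (cmod (g x)))\<^sup>2 \<partial>M)"
    by (rule Cauchy_Schwarz_nn_integral) auto
  also have "(\<integral>\<^sup>+x. ennreal (cmod (f x)) * ennreal (cmod (g x)) \<partial>M) = ennreal ?I"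
    using int by (simp add: nn_integral_eq_integral flip: ennreal_mult)
  finally have "ennreal (?I\<^sup>2) \<le> ennreal ((l2norm M f)\<^sup>2 * (l2norm M g)\<^sup>2)"
    using I nn_integral_square[OF f] nn_integral_square[OF g]
    by (simp add: ennreal_power ennreal_mult)
  then have "?I\<^sup>2 \<le> (l2norm M f * l2norm M g)\<^sup>2"
    by (simp add: power_mult_distrib)
  then show "?I \<le> l2norm M f * l2norm M g"
    by (rule power2_le_imp_le) simp
qed

lemma integrable_mult_square_integrable:
  assumes f: "f \<in> square_integrable M" and g: "g \<in> square_integrable M"
  shows "integrable M (\<lambda>x. f x * g x)"
proof -
  have [measurable]: "f \<in> borel_measurable M" "g \<in> borel_measurable M"
    using assms by (auto simp: square_integrable_def)
  show ?thesis
    by (rule Bochner_Integration.integrable_bound[OF Cauchy_Schwarz_l2norm(1)[OF f g]])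
       (auto simp: norm_mult)
qed

lemma square_integrable_cnj:
  "f \<in> square_integrable M \<Longrightarrow> (\<lambda>x. cnj (f x)) \<in> square_integrable M"
  by (auto simp: square_integrable_def intro: borel_measurable_continuous_onI[OF continuous_on_cnj, THEN measurable_compose[rotated]])

lemma l2norm_triangle:
  assumes f: "f \<in> square_integrable M" and g: "g \<in> square_integrable M"
  shows "l2norm M (\<lambda>x. f x + g x) \<le> l2norm M f + l2norm M g"
proof (rule power2_le_imp_le)
  note CS = Cauchy_Schwarz_l2norm[OF f g]
  have sq: "integrable M (\<lambda>x. (cmod (f x))\<^sup>2)" "integrable M (\<lambda>x. (cmod (g x))\<^sup>2)"
    using f g by (auto simp: square_integrable_def)
  have "(l2norm M (\<lambda>x. f x + g x))\<^sup>2 = (\<integral>x. (cmod (f x + g x))\<^sup>2 \<partial>M)"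
    by (rule l2norm_power2)
  also have "\<dots> \<le> (\<integral>x. (cmod (f x))\<^sup>2 + (cmod (g x))\<^sup>2 + 2 * (cmod (f x) * cmod (g x)) \<partial>M)"
  proof (rule integral_mono)
    show "integrable M (\<lambda>x. (cmod (f x + g x))\<^sup>2)"
      using square_integrable_add[OF f g] by (simp add: square_integrable_def)
    show "integrable M (\<lambda>x. (cmod (f x))\<^sup>2 + (cmod (g x))\<^sup>2 + 2 * (cmod (f x) * cmod (g x)))"
      using sq CS(1) by auto
    show "(cmod (f x + g x))\<^sup>2 \<le> (cmod (f x))\<^sup>2 + (cmod (g x))\<^sup>2 + 2 * (cmod (f x) * cmod (g x))" for x
      using power_mono[OF norm_triangle_ineq[of "f x" "g x"], of 2]
      by (simp add: power2_sum mult.assoc)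
  qed
  also have "\<dots> = (l2norm M f)\<^sup>2 + (l2norm M g)\<^sup>2 + 2 * (\<integral>x. cmod (f x) * cmod (g x) \<partial>M)"
    using sq CS(1) by (simp add: l2norm_power2)
  also have "\<dots> \<le> (l2norm M f + l2norm M g)\<^sup>2"
    using CS(2) by (simp add: power2_sum)
  finally show "(l2norm M (\<lambda>x. f x + g x))\<^sup>2 \<le> (l2norm M f + l2norm M g)\<^sup>2" .
qed simp

lemma l2norm_triangle_diff:
  assumes f: "f \<in> square_integrable M" and g: "g \<in> square_integrable M" and h: "h \<in> square_integrable M"
  shows "l2norm M (\<lambda>x. f x - h x) \<le> l2norm M (\<lambda>x. f x - g x) + l2norm M (\<lambda>x. g x - h x)"
  using l2norm_triangle[OF square_integrable_diff[OF f g] square_integrable_diff[OF g h]] by simp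

lemma l2norm_triangle_sub:
  assumes f: "f \<in> square_integrable M" and g: "g \<in> square_integrable M"
  shows "\<bar>l2norm M f - l2norm M g\<bar> \<le> l2norm M (\<lambda>x. f x - g x)"
  using l2norm_triangle[OF g square_integrable_diff[OF f g]]
    l2norm_triangle[OF f square_integrable_diff[OF g f]] l2norm_minus_commute[of M f g]
  by simp

text \<open>
  Polarization reduces the preservation of inner products by a linear map to the preservation
  of norms. The coefficients \<open>1\<close>, \<open>-1\<close>, \<open>\<i>\<close>, \<open>-\<i>\<close> all appear as factors of \<open>g\<close>, so that one
  statement about \<open>f + c g\<close> rewrites all four terms.
\<close>

lemma l2norm_polarization:
  assumes f: "f \<in> square_integrable M" and g: "g \<in> square_integrable M"
  shows "(\<integral>x. f x * cnj (g x) \<partial>M) =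
    (of_real ((l2norm M (\<lambda>x. f x + 1 * g x))\<^sup>2) - of_real ((l2norm M (\<lambda>x. f x + (-1) * g x))\<^sup>2)
      + \<i> * of_real ((l2norm M (\<lambda>x. f x + \<i> * g x))\<^sup>2)
      - \<i> * of_real ((l2norm M (\<lambda>x. f x + (-\<i>) * g x))\<^sup>2)) / 4"
proof -
  have int: "integrable M (\<lambda>x. f x * cnj (f x))" "integrable M (\<lambda>x. g x * cnj (g x))"
    "integrable M (\<lambda>x. f x * cnj (g x))" "integrable M (\<lambda>x. g x * cnj (f x))"
    using f g by (auto intro!: integrable_mult_square_integrable square_integrable_cnj)
  have "of_real ((l2norm M (\<lambda>x. f x + c * g x))\<^sup>2) =
      (\<integral>x. f x * cnj (f x) \<partial>M) + c * cnj c * (\<integral>x. g x * cnj (g x) \<partial>M)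
      + cnj c * (\<integral>x. f x * cnj (g x) \<partial>M) + c * (\<integral>x. g x * cnj (f x) \<partial>M)" for c
  proof -
    have "of_real ((l2norm M (\<lambda>x. f x + c * g x))\<^sup>2)
        = (\<integral>x. of_real ((cmod (f x + c * g x))\<^sup>2) \<partial>M :: complex)"
      unfolding l2norm_power2 by (rule integral_complex_of_real[symmetric])
    also have "\<dots> = (\<integral>x. f x * cnj (f x) + c * cnj c * (g x * cnj (g x))
        + cnj c * (f x * cnj (g x)) + c * (g x * cnj (f x)) \<partial>M)"
      by (intro Bochner_Integration.integral_cong refl, subst complex_norm_square)
         (simp add: algebra_simps)
    also have "\<dots> = (\<integral>x. f x * cnj (f x) \<partial>M) + c * cnj c * (\<integral>x. g x * cnj (g x) \<partial>M)
      + cnj c * (\<integral>x. f x * cnj (g x) \<partial>M) + c * (\<integral>x. g x * cnj (f x) \<partial>M)"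
      using int by simp
    finally show ?thesis .
  qed
  note * = this[of 1] this[of "-1"] this[of \<i>] this[of "-\<i>"]
  show ?thesis unfolding * by (simp add: algebra_simps)
qed

context real_distribution
begin

lemma square_integrable_bounded:
  assumes "f \<in> borel_measurable M" "\<And>x. cmod (f x) \<le> B"
  shows "f \<in> square_integrable M"
proof -
  note [measurable] = assms(1)
  have "integrable M (\<lambda>x. (cmod (f x))\<^sup>2)"
    by (rule integrable_const_bound[where B = "B\<^sup>2"]) (auto intro!: power_mono assms(2))
  then show ?thesis using assms(1) by (simp add: square_integrable_def)
qed

lemma square_integrable_const: "(\<lambda>x. c) \<in> square_integrable M"
  by (rule square_integrable_bounded[where B = "cmod c"]) auto

lemma l2norm_const: "l2norm M (\<lambda>x. c) = cmod c"
  by (simp add: l2norm_def prob_space[unfolded space_eq_univ])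

lemma square_integrable_imp_integrable:
  assumes "f \<in> square_integrable M" shows "integrable M f"
  using integrable_mult_square_integrable[OF assms square_integrable_const[of 1]] by simp

lemma integral_norm_le_l2norm:
  assumes "f \<in> square_integrable M"
  shows "(\<integral>x. cmod (f x) \<partial>M) \<le> l2norm M f"
  using Cauchy_Schwarz_l2norm(2)[OF assms square_integrable_const[of 1]]
  by (simp add: l2norm_const)

lemma norm_integral_le_l2norm:
  assumes "f \<in> square_integrable M"
  shows "cmod (\<integral>x. f x \<partial>M) \<le> l2norm M f"
  by (rule order_trans[OF integral_norm_bound integral_norm_le_l2norm[OF assms]])

lemma square_integrable_centred:
  "f \<in> square_integrable M \<Longrightarrow> centred M f \<in> square_integrable M"
  unfolding centred_def by (intro square_integrable_diff square_integrable_const)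

lemma integral_centred:
  "f \<in> square_integrable M \<Longrightarrow> (\<integral>x. centred M f x \<partial>M) = 0"
  by (simp add: centred_def square_integrable_imp_integrable prob_space[unfolded space_eq_univ])

text \<open>
  Completeness of \<open>L\<^sup>2\<close> in the Riesz-Fischer form. On a probability space the \<open>L\<^sup>1\<close> norm is at most
  the \<open>L\<^sup>2\<close> norm, so the increments of the sequence are summable in \<open>L\<^sup>1\<close> and therefore summable
  almost everywhere; the pointwise limit is the \<open>L\<^sup>2\<close> limit by Fatou's lemma. The geometric rate
  spares the choice of a subsequence.
\<close>

lemma L2_geometric_Cauchy_converges:
  assumes f: "\<And>n. f n \<in> square_integrable M"
    and Cauchy: "\<And>m n. m \<le> n \<Longrightarrow> l2norm M (\<lambda>x. f m x - f n x) \<le> (1/2)^m"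
  obtains g where "g \<in> square_integrable M" "\<And>n. l2norm M (\<lambda>x. f n x - g x) \<le> (1/2)^n"
proof -
  have [measurable]: "f n \<in> borel_measurable M" for n
    using f by (simp add: square_integrable_def)
  let ?d = "\<lambda>n x. f (Suc n) x - f n x"
  have d: "?d n \<in> square_integrable M" for n
    by (intro square_integrable_diff f)
  have AE_sum: "AE x in M. summable (\<lambda>n. cmod (?d n x))"
  proof -
    have "(\<integral>\<^sup>+x. (\<Sum>n. ennreal (cmod (?d n x))) \<partial>M) = (\<Sum>n. \<integral>\<^sup>+x. ennreal (cmod (?d n x)) \<partial>M)"
      by (rule nn_integral_suminf) simp
    also have "\<dots> \<le> (\<Sum>n. ennreal ((1/2)^n))"
    proof (rule suminf_le)
      fix n
      have "(\<integral>\<^sup>+x. ennreal (cmod (?d n x)) \<partial>M) = ennreal (\<integral>x. cmod (?d n x) \<partial>M)"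
        by (rule nn_integral_eq_integral)
           (use square_integrable_imp_integrable[OF d, of n] in auto)
      also have "\<dots> \<le> ennreal ((1/2)^n)"
        using integral_norm_le_l2norm[OF d, of n] Cauchy[of n "Suc n"]
        by (intro ennreal_leI) (simp add: l2norm_minus_commute)
      finally show "(\<integral>\<^sup>+x. ennreal (cmod (?d n x)) \<partial>M) \<le> ennreal ((1/2)^n)" .
    qed auto
    also have "\<dots> = ennreal (\<Sum>n. (1/2)^n)"
      by (intro suminf_ennreal2 summable_geometric) auto
    also have "\<dots> < \<infinity>" by simp
    finally have "(\<integral>\<^sup>+x. (\<Sum>n. ennreal (cmod (?d n x))) \<partial>M) \<noteq> \<infinity>" by simp
    then have "AE x in M. (\<Sum>n. ennreal (cmod (?d n x))) \<noteq> \<infinity>"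
      by (intro nn_integral_PInf_AE) auto
    then show ?thesis
      by eventually_elim (auto intro: summable_suminf_not_top)
  qed
  define g where "g = (\<lambda>x. lim (\<lambda>n. f n x))"
  have [measurable]: "g \<in> borel_measurable M"
    unfolding g_def by measurable
  have AE_lim: "AE x in M. (\<lambda>n. f n x) \<longlonglongrightarrow> g x"
    using AE_sum
  proof eventually_elim
    case (elim x)
    then have "summable (\<lambda>n. ?d n x)" by (rule summable_norm_cancel)
    then have "convergent (\<lambda>n. \<Sum>k<n. ?d k x)" by (simp add: summable_iff_convergent)
    then have "convergent (\<lambda>n. f n x - f 0 x)"
      by (simp add: sum_lessThan_telescope[of "\<lambda>k. f k x"])
    then have "convergent (\<lambda>n. f n x)"
      using convergent_add[OF _ convergent_const[of "f 0 x"], of "\<lambda>n. f n x - f 0 x"] by simp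
    then show ?case by (simp add: g_def convergent_LIMSEQ_iff)
  qed
  have Fatou: "(\<integral>\<^sup>+x. ennreal ((cmod (f n x - g x))\<^sup>2) \<partial>M) \<le> ennreal (((1/2)^n)\<^sup>2)" for n
  proof -
    have "(\<integral>\<^sup>+x. ennreal ((cmod (f n x - g x))\<^sup>2) \<partial>M)
        = (\<integral>\<^sup>+x. liminf (\<lambda>m. ennreal ((cmod (f n x - f m x))\<^sup>2)) \<partial>M)"
    proof (rule nn_integral_cong_AE, use AE_lim in eventually_elim)
      case (elim x)
      then have "(\<lambda>m. ennreal ((cmod (f n x - f m x))\<^sup>2)) \<longlonglongrightarrow> ennreal ((cmod (f n x - g x))\<^sup>2)"
        by (intro tendsto_intros)
      then show ?case by (metis lim_imp_Liminf sequentially_bot)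
    qed
    also have "\<dots> \<le> liminf (\<lambda>m. \<integral>\<^sup>+x. ennreal ((cmod (f n x - f m x))\<^sup>2) \<partial>M)"
      by (rule nn_integral_liminf) simp
    also have "\<dots> \<le> liminf (\<lambda>m. ennreal (((1/2)^n)\<^sup>2))"
    proof (rule Liminf_mono, rule eventually_sequentiallyI[of n])
      fix m assume "n \<le> m"
      then show "(\<integral>\<^sup>+x. ennreal ((cmod (f n x - f m x))\<^sup>2) \<partial>M) \<le> ennreal (((1/2)^n)\<^sup>2)"
        by (subst nn_integral_square[OF square_integrable_diff[OF f f]])
           (intro ennreal_leI power_mono Cauchy, auto)
    qed
    also have "\<dots> = ennreal (((1/2)^n)\<^sup>2)" by (simp add: Liminf_const)
    finally show ?thesis .
  qed
  have S: "(\<lambda>x. f n x - g x) \<in> square_integrable M" for n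
    using le_less_trans[OF Fatou ennreal_less_top, of n]
    by (auto simp: square_integrable_def infinity_ennreal_def intro!: integrableI_bounded)
  show ?thesis
  proof
    show "g \<in> square_integrable M"
      using square_integrable_diff[OF f[of 0] S[of 0]] by simp
    show "l2norm M (\<lambda>x. f n x - g x) \<le> (1/2)^n" for n
    proof (rule power2_le_imp_le)
      show "(l2norm M (\<lambda>x. f n x - g x))\<^sup>2 \<le> ((1/2)^n)\<^sup>2"
        using Fatou[of n] unfolding nn_integral_square[OF S] by simp
    qed simp
  qed
qed

end

section \<open>Spans of resolvents\<close>

definition resolvent_sum :: "complex set \<Rightarrow> (complex \<Rightarrow> complex) \<Rightarrow> real \<Rightarrow> complex" where
  "resolvent_sum A c = (\<lambda>x. \<Sum>z\<in>A. c z * (1 / (z - complex_of_real x)))"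

lemma resolvent_span_iff:
  "h \<in> resolvent_span \<longleftrightarrow> (\<exists>A c. finite A \<and> A \<inter> \<real> = {} \<and> h = resolvent_sum A c)"
  by (auto simp: resolvent_span_def resolvent_sum_def)

lemma norm_resolvent_le:
  assumes "z \<notin> \<real>"
  shows "cmod (1 / (z - complex_of_real x)) \<le> 1 / \<bar>Im z\<bar>"
proof -
  have "Im z \<noteq> 0" using assms by (simp add: complex_is_Real_iff)
  moreover have "\<bar>Im z\<bar> \<le> cmod (z - complex_of_real x)"
    using abs_Im_le_cmod[of "z - complex_of_real x"] by simp
  ultimately show ?thesis
    by (simp add: norm_divide frac_le)
qed

lemma minus_real_nonzero: "z \<notin> \<real> \<Longrightarrow> z - complex_of_real x \<noteq> 0"
  by auto

lemma resolvent_sum_add: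
  assumes "finite A" "finite B"
  shows "resolvent_sum A c x + k * resolvent_sum B d x =
    resolvent_sum (A \<union> B) (\<lambda>z. (if z \<in> A then c z else 0) + k * (if z \<in> B then d z else 0)) x"
proof -
  have "resolvent_sum A c x = (\<Sum>z\<in>A\<union>B. (if z \<in> A then c z else 0) * (1 / (z - complex_of_real x)))"
    unfolding resolvent_sum_def using assms by (intro sum.mono_neutral_cong_left) auto
  moreover have "resolvent_sum B d x = (\<Sum>z\<in>A\<union>B. (if z \<in> B then d z else 0) * (1 / (z - complex_of_real x)))"
    unfolding resolvent_sum_def using assms by (intro sum.mono_neutral_cong_left) auto
  ultimately show ?thesis
    by (simp only: resolvent_sum_def sum_distrib_left distrib_right sum.distrib mult.assoc)
qed

lemma resolvent_in_span: "z \<notin> \<real> \<Longrightarrow> (\<lambda>x. c * (1 / (z - complex_of_real x))) \<in> resolvent_span"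
  unfolding resolvent_span_iff
  by (intro exI[of _ "{z}"] exI[of _ "\<lambda>_. c"]) (auto simp: resolvent_sum_def)

lemma resolvent_span_add:
  assumes "f \<in> resolvent_span" "g \<in> resolvent_span"
  shows "(\<lambda>x. f x + k * g x) \<in> resolvent_span"
proof -
  obtain A c B d where "finite A" "A \<inter> \<real> = {}" "f = resolvent_sum A c"
    "finite B" "B \<inter> \<real> = {}" "g = resolvent_sum B d"
    using assms unfolding resolvent_span_iff by blast
  then show ?thesis
    unfolding resolvent_span_iff
    by (intro exI[of _ "A \<union> B"] exI conjI, force, force) (simp only: resolvent_sum_add)
qed

lemma zero_in_resolvent_span: "(\<lambda>x. 0) \<in> resolvent_span"
  unfolding resolvent_span_iff by (intro exI[of _ "{}"] exI) (auto simp: resolvent_sum_def)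

lemma resolvent_span_scale: "f \<in> resolvent_span \<Longrightarrow> (\<lambda>x. k * f x) \<in> resolvent_span"
  using resolvent_span_add[OF zero_in_resolvent_span, of f k] by simp

lemma resolvent_span_sum:
  assumes "\<And>i. i \<in> I \<Longrightarrow> f i \<in> resolvent_span"
  shows "(\<lambda>x. \<Sum>i\<in>I. f i x) \<in> resolvent_span"
  using assms
proof (induction I rule: infinite_finite_induct)
  case (insert i I)
  then show ?case using resolvent_span_add[of "\<lambda>x. \<Sum>i\<in>I. f i x" "f i" 1]
    by (simp add: add.commute)
qed (simp_all add: zero_in_resolvent_span)

section \<open>Density of the resolvents\<close>

text \<open>
  The Poisson kernel of the half-plane is the imaginary part of a resolvent. Its integral over
  \<open>t\<close> from \<open>a\<close> to \<open>b\<close> is \<open>arctan ((b-x)/e) - arctan ((a-x)/e)\<close>, which tends to a multiple of an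
  indicator function as \<open>e\<close> tends to \<open>0\<close>. Indicators of intervals are thus limits of Riemann sums
  of resolvents, and the remaining functions are reached by the usual measure-theoretic steps.
\<close>

definition poisson_kernel :: "real \<Rightarrow> real \<Rightarrow> real \<Rightarrow> real" where
  "poisson_kernel e t x = e / ((t - x)\<^sup>2 + e\<^sup>2)"

lemma poisson_kernel_eq_Im:
  "poisson_kernel e t x = Im (1 / (Complex t (-e) - complex_of_real x))"
  by (simp add: poisson_kernel_def complex_of_real_def Im_divide)

lemma poisson_kernel_in_span:
  assumes "0 < e"
  shows "(\<lambda>x. complex_of_real (poisson_kernel e t x)) \<in> resolvent_span"
proof -
  let ?z = "Complex t (-e)"
  have nz: "?z \<notin> \<real>" "cnj ?z \<notin> \<real>"
    using assms by (auto simp: complex_is_Real_iff)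
  have "complex_of_real (poisson_kernel e t x) =
      (1 / (2 * \<i>)) * (1 / (?z - complex_of_real x)) + (- 1 / (2 * \<i>)) * (1 / (cnj ?z - complex_of_real x))" for x
  proof -
    let ?w = "1 / (?z - complex_of_real x)"
    have cnj: "1 / (cnj ?z - complex_of_real x) = cnj ?w" by simp
    have "complex_of_real (Im w) = (1 / (2 * \<i>)) * w + (- 1 / (2 * \<i>)) * cnj w" for w
      using complex_diff_cnj[of w] by (simp add: field_simps)
    then show ?thesis unfolding poisson_kernel_eq_Im cnj .
  qed
  then show ?thesis
    using resolvent_span_add[OF resolvent_in_span[OF nz(1), of "1 / (2 * \<i>)"]
        resolvent_in_span[OF nz(2), of 1], of "- 1 / (2 * \<i>)"]
    by simp
qed

lemma poisson_kernel_Lipschitz: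
  assumes "0 < e"
  shows "\<bar>poisson_kernel e s x - poisson_kernel e t x\<bar> \<le> \<bar>s - t\<bar> / e\<^sup>2"
proof -
  let ?z = "Complex s (-e)" and ?w = "Complex t (-e)"
  have nz: "?z \<notin> \<real>" "?w \<notin> \<real>"
    using assms by (auto simp: complex_is_Real_iff)
  let ?p = "1 / (?z - complex_of_real x)" and ?q = "1 / (?w - complex_of_real x)"
  have "?w - ?z = complex_of_real (t - s)" by (simp add: complex_eq_iff)
  then have wz: "cmod (?w - ?z) = \<bar>s - t\<bar>" by (simp only: norm_of_real abs_minus_commute)
  have "\<bar>poisson_kernel e s x - poisson_kernel e t x\<bar> = \<bar>Im (?p - ?q)\<bar>"
    by (simp add: poisson_kernel_eq_Im)
  also have "\<dots> \<le> cmod (?p - ?q)" by (rule abs_Im_le_cmod)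
  also have "?p - ?q = (?w - ?z) * (?p * ?q)"
    using minus_real_nonzero[OF nz(1), of x] minus_real_nonzero[OF nz(2), of x]
    by (simp add: divide_simps)
  also have "cmod \<dots> = \<bar>s - t\<bar> * (cmod ?p * cmod ?q)"
    by (simp only: norm_mult wz)
  also have "\<dots> \<le> \<bar>s - t\<bar> * ((1/e) * (1/e))"
    using norm_resolvent_le[OF nz(1), of x] norm_resolvent_le[OF nz(2), of x] assms
    by (intro mult_left_mono mult_mono) auto
  finally show ?thesis by (simp add: power2_eq_square)
qed

text \<open>
  By the mean value theorem the increment is \<open>h\<close> times the kernel at an intermediate point, which
  lies within \<open>h\<close> of \<open>t\<close>; the Lipschitz bound does the rest.
\<close>

lemma arctan_Riemann_step:
  assumes "0 < e" "0 < h"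
  shows "\<bar>arctan ((t + h - x) / e) - arctan ((t - x) / e) - h * poisson_kernel e t x\<bar> \<le> h\<^sup>2 / e\<^sup>2"
proof -
  have "((\<lambda>s. arctan ((s - x) / e)) has_real_derivative poisson_kernel e s x) (at s)" for s
  proof -
    have "0 < (s - x)\<^sup>2 + e\<^sup>2" using \<open>0 < e\<close> by (simp add: add_nonneg_pos)
    then show ?thesis
      using \<open>0 < e\<close>
      by (auto intro!: derivative_eq_intros simp: poisson_kernel_def power2_eq_square divide_simps)
  qed
  then obtain s where s: "t < s" "s < t + h"
    "arctan ((t + h - x) / e) - arctan ((t - x) / e) = h * poisson_kernel e s x"
    using MVT2[of t "t + h" "\<lambda>s. arctan ((s - x) / e)" "\<lambda>s. poisson_kernel e s x"] \<open>0 < h\<close> by auto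
  have "\<bar>h * poisson_kernel e s x - h * poisson_kernel e t x\<bar>
      = h * \<bar>poisson_kernel e s x - poisson_kernel e t x\<bar>"
    using \<open>0 < h\<close> by (simp add: abs_mult flip: right_diff_distrib)
  also have "\<dots> \<le> h * (\<bar>s - t\<bar> / e\<^sup>2)"
    using poisson_kernel_Lipschitz[OF \<open>0 < e\<close>, of s x t] \<open>0 < h\<close> by (intro mult_left_mono) auto
  also have "\<dots> \<le> h * (h / e\<^sup>2)"
    using s \<open>0 < h\<close> by (intro mult_left_mono divide_right_mono) auto
  finally show ?thesis using s by (simp add: power2_eq_square)
qed

lemma arctan_Riemann_sum:
  assumes "0 < e" "a < b" "0 < n"
  defines "h \<equiv> (b - a) / real n"
  shows "\<bar>arctan ((b - x) / e) - arctan ((a - x) / e) - (\<Sum>k<n. h * poisson_kernel e (a + real k * h) x)\<bar>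
     \<le> (b - a)\<^sup>2 / e\<^sup>2 / real n"
proof -
  have "0 < h" using assms by simp
  let ?f = "\<lambda>k. arctan ((a + real k * h - x) / e)"
  have "arctan ((b - x) / e) - arctan ((a - x) / e) = ?f n - ?f 0"
    using \<open>0 < n\<close> by (simp add: h_def)
  also have "\<dots> = (\<Sum>k<n. ?f (Suc k) - ?f k)"
    by (rule sum_lessThan_telescope[symmetric])
  finally have telescope: "arctan ((b - x) / e) - arctan ((a - x) / e) = (\<Sum>k<n. ?f (Suc k) - ?f k)" .
  have "\<bar>arctan ((b - x) / e) - arctan ((a - x) / e) - (\<Sum>k<n. h * poisson_kernel e (a + real k * h) x)\<bar>
      = \<bar>\<Sum>k<n. ?f (Suc k) - ?f k - h * poisson_kernel e (a + real k * h) x\<bar>"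
    unfolding telescope by (simp only: sum_subtractf)
  also have "\<dots> \<le> (\<Sum>k<n. \<bar>?f (Suc k) - ?f k - h * poisson_kernel e (a + real k * h) x\<bar>)"
    by (rule sum_abs)
  also have "\<dots> \<le> (\<Sum>k<n. h\<^sup>2 / e\<^sup>2)"
  proof (rule sum_mono)
    fix k
    show "\<bar>?f (Suc k) - ?f k - h * poisson_kernel e (a + real k * h) x\<bar> \<le> h\<^sup>2 / e\<^sup>2"
      using arctan_Riemann_step[OF \<open>0 < e\<close> \<open>0 < h\<close>, of "a + real k * h" x]
      by (simp add: algebra_simps)
  qed
  also have "\<dots> = (real n * h) * h / e\<^sup>2" by (simp add: power2_eq_square)
  also have "\<dots> = (b - a)\<^sup>2 / e\<^sup>2 / real n"
    using \<open>0 < n\<close> by (simp add: h_def power2_eq_square)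
  finally show ?thesis .
qed

lemma abs_arctan_diff_le: "\<bar>arctan u - arctan v\<bar> \<le> pi"
  using arctan_bounded[of u] arctan_bounded[of v] by linarith

text \<open>
  The summand \<open>n\<close> moves the jump of the limit slightly to the left of \<open>0\<close>, so that the value at
  \<open>c = 0\<close> is \<open>pi/2\<close> and not \<open>0\<close>. This is what makes the limit in
  \<open>interval_indicator_in_closure\<close> the indicator of the closed interval, with full weight at
  the endpoints, which may be atoms.
\<close>

lemma arctan_steep_limit:
  fixes c :: real
  shows "(\<lambda>n. arctan (real (Suc n)^2 * c + real (Suc n))) \<longlonglongrightarrow> (if 0 \<le> c then pi/2 else - (pi/2))"
proof -
  have N: "filterlim (\<lambda>n. real (Suc n)) at_top sequentially"
    by (rule filterlim_compose[OF filterlim_real_sequentially filterlim_Suc])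
  show ?thesis
  proof (cases "0 \<le> c")
    case True
    then have "filterlim (\<lambda>n. real (Suc n)^2 * c + real (Suc n)) at_top sequentially"
      by (intro filterlim_at_top_mono[OF N] always_eventually) simp
    then show ?thesis
      using True filterlim_compose[OF tendsto_arctan_at_top] by simp
  next
    case False
    have "eventually (\<lambda>n. 2 / - c \<le> real (Suc n)) sequentially"
      using N by (simp add: filterlim_at_top)
    then have "eventually (\<lambda>n. real (Suc n)^2 * c + real (Suc n) \<le> - real (Suc n)) sequentially"
    proof eventually_elim
      case (elim n)
      have "N^2 * c + N \<le> - N" if "2 / - c \<le> N" "0 \<le> N" for N :: real
      proof -
        have "N * c + 2 \<le> 0" using that False by (simp add: field_simps)
        then have "N * (N * c + 2) \<le> 0" using that by (intro mult_nonneg_nonpos)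
        then show ?thesis by (simp add: power2_eq_square algebra_simps)
      qed
      from this[OF elim] show ?case by simp
    qed
    moreover have "filterlim (\<lambda>n. - real (Suc n)) at_bot sequentially"
      using N by (simp add: filterlim_uminus_at_top)
    ultimately have "filterlim (\<lambda>n. real (Suc n)^2 * c + real (Suc n)) at_bot sequentially"
      by (rule filterlim_at_bot_mono[rotated])
    then show ?thesis
      using False filterlim_compose[OF tendsto_arctan_at_bot] by simp
  qed
qed

definition resolvent_closure :: "real measure \<Rightarrow> (real \<Rightarrow> complex) set" where
  "resolvent_closure M = {f \<in> square_integrable M.
     \<forall>e>0. \<exists>h\<in>resolvent_span. l2norm M (\<lambda>x. f x - h x) < e}"

context real_distribution
begin

lemma resolvent_measurable [measurable]: "(\<lambda>x. 1 / (z - complex_of_real x)) \<in> borel_measurable M"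
  by measurable

lemma resolvent_square_integrable:
  assumes "z \<notin> \<real>"
  shows "(\<lambda>x. 1 / (z - complex_of_real x)) \<in> square_integrable M"
  by (rule square_integrable_bounded[OF resolvent_measurable norm_resolvent_le[OF assms]])

lemma resolvent_sum_square_integrable:
  assumes "finite A" "A \<inter> \<real> = {}"
  shows "resolvent_sum A c \<in> square_integrable M"
  using assms
proof (induction A rule: finite_induct)
  case empty
  then show ?case using square_integrable_const[of 0] by (simp add: resolvent_sum_def)
next
  case (insert z A)
  then have "(\<lambda>x. c z * (1 / (z - complex_of_real x)) + resolvent_sum A c x) \<in> square_integrable M"
    by (intro square_integrable_add square_integrable_scale resolvent_square_integrable) auto
  then show ?case using insert.hyps by (simp add: resolvent_sum_def)
qed

lemma resolvent_span_square_integrable: "h \<in> resolvent_span \<Longrightarrow> h \<in> square_integrable M"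
  by (auto simp: resolvent_span_iff intro: resolvent_sum_square_integrable)

lemma resolvent_span_closure: "h \<in> resolvent_span \<Longrightarrow> h \<in> resolvent_closure M"
  using resolvent_span_square_integrable by (force simp: resolvent_closure_def l2norm_def)

lemma resolvent_closure_add:
  assumes f: "f \<in> resolvent_closure M" and g: "g \<in> resolvent_closure M"
  shows "(\<lambda>x. f x + k * g x) \<in> resolvent_closure M"
proof -
  have S: "f \<in> square_integrable M" "g \<in> square_integrable M"
    using f g by (auto simp: resolvent_closure_def)
  have "\<exists>h\<in>resolvent_span. l2norm M (\<lambda>x. f x + k * g x - h x) < e" if "0 < e" for e
  proof -
    have K: "0 < 1 + cmod k" by (simp add: add_pos_nonneg)
    obtain u where u: "u \<in> resolvent_span" "l2norm M (\<lambda>x. f x - u x) < e / 2"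
      using f \<open>0 < e\<close> unfolding resolvent_closure_def by (auto dest: spec[of _ "e/2"])
    obtain v where v: "v \<in> resolvent_span" "l2norm M (\<lambda>x. g x - v x) < e / 2 / (1 + cmod k)"
      using g \<open>0 < e\<close> K unfolding resolvent_closure_def
      by (auto dest: spec[of _ "e / 2 / (1 + cmod k)"])
    have Suv: "u \<in> square_integrable M" "v \<in> square_integrable M"
      using u v by (auto intro: resolvent_span_square_integrable)
    have "l2norm M (\<lambda>x. f x + k * g x - (u x + k * v x))
        = l2norm M (\<lambda>x. (f x - u x) + k * (g x - v x))"
      by (simp add: algebra_simps)
    also have "\<dots> \<le> l2norm M (\<lambda>x. f x - u x) + l2norm M (\<lambda>x. k * (g x - v x))"
      by (intro l2norm_triangle square_integrable_scale square_integrable_diff S Suv)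
    also have "l2norm M (\<lambda>x. k * (g x - v x)) = cmod k * l2norm M (\<lambda>x. g x - v x)"
      by (rule l2norm_scale)
    also have "\<dots> \<le> (1 + cmod k) * (e / 2 / (1 + cmod k))"
      using v by (intro mult_mono) auto
    also have "\<dots> = e / 2"
      using K by (subst times_divide_eq_right, subst nonzero_mult_div_cancel_left) auto
    finally have "l2norm M (\<lambda>x. f x + k * g x - (u x + k * v x)) < e"
      using u by simp
    then show ?thesis using resolvent_span_add[OF u(1) v(1), of k] by (rule bexI)
  qed
  then show ?thesis
    using S by (auto simp: resolvent_closure_def intro!: square_integrable_add square_integrable_scale)
qed

lemma resolvent_closure_zero: "(\<lambda>x. 0) \<in> resolvent_closure M"
  by (rule resolvent_span_closure[OF zero_in_resolvent_span])

lemma resolvent_closure_scale: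
  "f \<in> resolvent_closure M \<Longrightarrow> (\<lambda>x. k * f x) \<in> resolvent_closure M"
  using resolvent_closure_add[OF resolvent_closure_zero, of f k] by simp

lemma resolvent_closure_sum:
  assumes "\<And>i. i \<in> I \<Longrightarrow> f i \<in> resolvent_closure M"
  shows "(\<lambda>x. \<Sum>i\<in>I. f i x) \<in> resolvent_closure M"
  using assms
proof (induction I rule: infinite_finite_induct)
  case (insert i I)
  then show ?case using resolvent_closure_add[of "\<lambda>x. \<Sum>i\<in>I. f i x" "f i" 1]
    by (simp add: add.commute)
qed (simp_all add: resolvent_closure_zero)

lemma resolvent_closure_closed:
  assumes f: "f \<in> square_integrable M"
    and approx: "\<And>e. 0 < e \<Longrightarrow> \<exists>g\<in>resolvent_closure M. l2norm M (\<lambda>x. f x - g x) < e"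
  shows "f \<in> resolvent_closure M"
proof -
  have "\<exists>h\<in>resolvent_span. l2norm M (\<lambda>x. f x - h x) < e" if "0 < e" for e
  proof -
    obtain g where g: "g \<in> resolvent_closure M" "l2norm M (\<lambda>x. f x - g x) < e / 2"
      using approx[of "e/2"] \<open>0 < e\<close> by auto
    then obtain h where h: "h \<in> resolvent_span" "l2norm M (\<lambda>x. g x - h x) < e / 2"
      using \<open>0 < e\<close> unfolding resolvent_closure_def by (auto dest: spec[of _ "e/2"])
    have "l2norm M (\<lambda>x. f x - h x) < e"
      using l2norm_triangle_diff[OF f _ resolvent_span_square_integrable[OF h(1)], of g] g h
      by (auto simp: resolvent_closure_def)
    then show ?thesis using h by blast
  qed
  then show ?thesis using f by (auto simp: resolvent_closure_def)
qed

text \<open>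
  Dominated convergence makes \<open>resolvent_closure\<close> stable under dominated pointwise limits; every
  limit step below is an instance.
\<close>

lemma resolvent_closure_dominated:
  assumes s: "\<And>n. s n \<in> resolvent_closure M"
    and lim: "\<And>x. (\<lambda>n. s n x) \<longlonglongrightarrow> f x"
    and bound: "\<And>n x. cmod (s n x) \<le> w x"
    and w: "integrable M (\<lambda>x. (w x)\<^sup>2)"
  shows "f \<in> resolvent_closure M"
proof -
  have sS: "s n \<in> square_integrable M" for n
    using s by (simp add: resolvent_closure_def)
  have sm [measurable]: "s n \<in> borel_measurable M" for n
    using sS by (rule square_integrable_measurable)
  have fm [measurable]: "f \<in> borel_measurable M"
    by (rule borel_measurable_LIMSEQ_metric[of s]) (use lim in auto)
  have f_bound: "cmod (f x) \<le> w x" for x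
    by (rule LIMSEQ_le_const2[OF tendsto_norm[OF lim]]) (use bound in auto)
  have "integrable M (\<lambda>x. (cmod (f x))\<^sup>2)"
    by (rule Bochner_Integration.integrable_bound[OF w]) (auto intro!: power_mono f_bound)
  then have fS: "f \<in> square_integrable M"
    by (simp add: square_integrable_def)
  have "(\<lambda>n. \<integral>x. (cmod (f x - s n x))\<^sup>2 \<partial>M) \<longlonglongrightarrow> (\<integral>x. 0 \<partial>M)"
  proof (rule integral_dominated_convergence[where w = "\<lambda>x. 4 * (w x)\<^sup>2"])
    show "integrable M (\<lambda>x. 4 * (w x)\<^sup>2)" using w by simp
    show "AE x in M. (\<lambda>n. (cmod (f x - s n x))\<^sup>2) \<longlonglongrightarrow> 0"
    proof (rule AE_I2)
      fix x
      have "(\<lambda>n. (cmod (f x - s n x))\<^sup>2) \<longlonglongrightarrow> (cmod (f x - f x))\<^sup>2"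
        by (intro tendsto_intros lim)
      then show "(\<lambda>n. (cmod (f x - s n x))\<^sup>2) \<longlonglongrightarrow> 0" by simp
    qed
    show "AE x in M. norm ((cmod (f x - s n x))\<^sup>2) \<le> 4 * (w x)\<^sup>2" for n
    proof (rule AE_I2)
      fix x
      have "cmod (f x - s n x) \<le> 2 * w x"
        using norm_triangle_ineq4[of "f x" "s n x"] f_bound[of x] bound[of n x] by simp
      then have "(cmod (f x - s n x))\<^sup>2 \<le> (2 * w x)\<^sup>2" by (rule power_mono) simp
      then show "norm ((cmod (f x - s n x))\<^sup>2) \<le> 4 * (w x)\<^sup>2" by (simp add: power_mult_distrib)
    qed
  qed auto
  then have "(\<lambda>n. l2norm M (\<lambda>x. f x - s n x)) \<longlonglongrightarrow> sqrt 0"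
    unfolding l2norm_def by (intro tendsto_real_sqrt) simp
  then have lim0: "(\<lambda>n. l2norm M (\<lambda>x. f x - s n x)) \<longlonglongrightarrow> 0" by simp
  show ?thesis
  proof (rule resolvent_closure_closed[OF fS])
    fix e :: real assume "0 < e"
    then have "eventually (\<lambda>n. l2norm M (\<lambda>x. f x - s n x) < e) sequentially"
      using lim0 by (rule order_tendstoD(2)[rotated])
    then obtain n where "l2norm M (\<lambda>x. f x - s n x) < e"
      by (auto simp: eventually_sequentially)
    then show "\<exists>g\<in>resolvent_closure M. l2norm M (\<lambda>x. f x - g x) < e" using s by blast
  qed
qed

lemma resolvent_closure_bounded:
  assumes "\<And>n. s n \<in> resolvent_closure M" "\<And>x. (\<lambda>n. s n x) \<longlonglongrightarrow> f x"
    and "\<And>n x. cmod (s n x) \<le> B"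
  shows "f \<in> resolvent_closure M"
  by (rule resolvent_closure_dominated[OF assms(1,2), where w = "\<lambda>_. B"]) (auto intro: assms(3))

lemma arctan_difference_in_closure:
  assumes "0 < e" "a < b"
  shows "(\<lambda>x. complex_of_real (arctan ((b - x) / e) - arctan ((a - x) / e))) \<in> resolvent_closure M"
proof (rule resolvent_closure_bounded)
  define h where "h = (\<lambda>n. (b - a) / real (Suc n))"
  define s where "s = (\<lambda>n x. \<Sum>k<Suc n. h n * poisson_kernel e (a + real k * h n) x)"
  let ?D = "\<lambda>x. arctan ((b - x) / e) - arctan ((a - x) / e)"
  have err: "\<bar>?D x - s n x\<bar> \<le> (b - a)\<^sup>2 / e\<^sup>2 / real (Suc n)" for n x
    unfolding s_def h_def by (rule arctan_Riemann_sum[OF assms]) simp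
  show "(\<lambda>x. complex_of_real (s n x)) \<in> resolvent_closure M" for n
  proof (rule resolvent_span_closure)
    have "(\<lambda>x. \<Sum>k<Suc n. complex_of_real (h n) * complex_of_real (poisson_kernel e (a + real k * h n) x))
        \<in> resolvent_span"
      by (intro resolvent_span_sum resolvent_span_scale poisson_kernel_in_span \<open>0 < e\<close>)
    then show "(\<lambda>x. complex_of_real (s n x)) \<in> resolvent_span"
      unfolding s_def of_real_sum of_real_mult .
  qed
  show "(\<lambda>n. complex_of_real (s n x)) \<longlonglongrightarrow> complex_of_real (?D x)" for x
  proof (rule tendsto_of_real, rule LIM_zero_cancel, rule tendsto_norm_zero_cancel,
      rule tendsto_sandwich[OF _ _ tendsto_const])
    show "(\<lambda>n. (b - a)\<^sup>2 / e\<^sup>2 / real (Suc n)) \<longlonglongrightarrow> 0"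
      using tendsto_mult[OF tendsto_const[of "(b - a)\<^sup>2 / e\<^sup>2"] LIMSEQ_inverse_real_of_nat]
      by (simp add: divide_inverse)
    show "\<forall>\<^sub>F n in sequentially. norm (s n x - ?D x) \<le> (b - a)\<^sup>2 / e\<^sup>2 / real (Suc n)"
      using err[of x] by (auto simp: abs_minus_commute)
  qed auto
  show "cmod (complex_of_real (s n x)) \<le> pi + (b - a)\<^sup>2 / e\<^sup>2" for n x
  proof -
    have "\<bar>?D x\<bar> \<le> pi" by (rule abs_arctan_diff_le)
    moreover have "(b - a)\<^sup>2 / e\<^sup>2 / real (Suc n) \<le> (b - a)\<^sup>2 / e\<^sup>2"
      using divide_left_mono[of 1 "real (Suc n)" "(b - a)\<^sup>2 / e\<^sup>2"] by simp
    moreover have "\<bar>v\<bar> \<le> p + r" if "\<bar>u\<bar> \<le> p" "\<bar>u - v\<bar> \<le> q" "q \<le> r" for p q r u v :: real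
      using that by linarith
    ultimately have "\<bar>s n x\<bar> \<le> pi + (b - a)\<^sup>2 / e\<^sup>2" using err[of x n] by blast
    then show ?thesis by (simp only: norm_of_real)
  qed
qed

text \<open>
  The interval is widened by \<open>1/n\<close> on each side while the kernel has width \<open>1/n\<^sup>2\<close>; the widening
  wins, and points of the boundary are treated as interior points.
\<close>

lemma interval_indicator_in_closure:
  assumes "a \<le> b"
  shows "(\<lambda>x. indicator {a..b} x) \<in> resolvent_closure M"
proof (rule resolvent_closure_bounded)
  let ?N = "\<lambda>n. real (Suc n)"
  let ?A = "\<lambda>n x. arctan ((b + 1 / ?N n - x) / (1 / (?N n)^2)) - arctan ((a - 1 / ?N n - x) / (1 / (?N n)^2))"
  have A: "?A n x = arctan ((?N n)^2 * (b - x) + ?N n) + arctan ((?N n)^2 * (x - a) + ?N n)" for n x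
  proof -
    have "(b + 1 / N - x) / (1 / N^2) = N^2 * (b - x) + N"
      "(a - 1 / N - x) / (1 / N^2) = - (N^2 * (x - a) + N)" if "0 < N" for N :: real
      using that by (simp_all add: power2_eq_square algebra_simps)
    from this[of "?N n"] show ?thesis by (simp only: arctan_minus)
  qed
  show "(\<lambda>x. complex_of_real (1 / pi) * complex_of_real (?A n x)) \<in> resolvent_closure M" for n
  proof (intro resolvent_closure_scale arctan_difference_in_closure)
    have "a - r < b + r" if "0 < r" for r using assms that by linarith
    show "a - 1 / ?N n < b + 1 / ?N n" by (rule \<open>\<And>r. 0 < r \<Longrightarrow> a - r < b + r\<close>) simp
    show "0 < 1 / (?N n)\<^sup>2" by simp
  qed
  show "(\<lambda>n. complex_of_real (1 / pi) * complex_of_real (?A n x)) \<longlonglongrightarrow> indicator {a..b} x" for x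
  proof -
    have "(\<lambda>n. 1 / pi * ?A n x) \<longlonglongrightarrow>
        1 / pi * ((if 0 \<le> b - x then pi/2 else - (pi/2)) + (if 0 \<le> x - a then pi/2 else - (pi/2)))"
      unfolding A by (rule tendsto_mult[OF tendsto_const tendsto_add[OF arctan_steep_limit arctan_steep_limit]])
    also have "1 / pi * ((if 0 \<le> b - x then pi/2 else - (pi/2)) + (if 0 \<le> x - a then pi/2 else - (pi/2)))
        = indicator {a..b} x"
      using assms by (cases "x < a"; cases "b < x") (simp_all add: indicator_def)
    finally have "(\<lambda>n. complex_of_real (1 / pi * ?A n x)) \<longlonglongrightarrow> complex_of_real (indicator {a..b} x)"
      by (rule tendsto_of_real)
    then show ?thesis by (simp only: of_real_mult of_real_indicator)
  qed
  show "cmod (complex_of_real (1 / pi) * complex_of_real (?A n x)) \<le> 1" for n x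
  proof -
    have "cmod (complex_of_real (1 / pi) * complex_of_real u) \<le> 1" if "\<bar>u\<bar> \<le> pi" for u
      using that by (simp add: norm_mult norm_divide)
    from this[OF abs_arctan_diff_le] show ?thesis .
  qed
qed

lemma one_in_closure: "(\<lambda>x. 1) \<in> resolvent_closure M"
proof (rule resolvent_closure_bounded)
  show "(\<lambda>x. indicator {- real n..real n} x) \<in> resolvent_closure M" for n
    by (rule interval_indicator_in_closure) simp
  show "(\<lambda>n. indicator {- real n..real n} x) \<longlonglongrightarrow> (1 :: complex)" for x
  proof (rule tendsto_eventually)
    show "\<forall>\<^sub>F n in sequentially. indicator {- real n..real n} x = (1 :: complex)"
      using eventually_ge_at_top[of "nat \<lceil>\<bar>x\<bar>\<rceil>"]
      by eventually_elim (auto simp: indicator_def)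
  qed
  show "cmod (indicator {- real n..real n} x) \<le> 1" for n x
    by (simp add: indicator_def)
qed

lemma indicator_in_closure:
  assumes "A \<in> sets borel"
  shows "(\<lambda>x. indicator A x) \<in> resolvent_closure M"
  using assms
proof (induction rule: borel_set_induct)
  case empty
  then show ?case using resolvent_closure_zero by simp
next
  case (interval a b)
  then show ?case by (rule interval_indicator_in_closure)
next
  case (compl A)
  then show ?case using resolvent_closure_add[OF one_in_closure compl.IH, of "-1"]
    by (simp add: indicator_compl)
next
  case (union F)
  show ?case
  proof (rule resolvent_closure_bounded)
    have eq: "(\<Sum>i<n. indicator (F i) x :: complex) = indicator (\<Union>i<n. F i) x" for n x
      using union.hyps(1) by (intro indicator_UN_disjoint[symmetric]) (auto simp: disjoint_family_on_def)
    show "(\<lambda>x. \<Sum>i<n. indicator (F i) x) \<in> resolvent_closure M" for n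
      by (intro resolvent_closure_sum union.IH)
    show "(\<lambda>n. \<Sum>i<n. indicator (F i) x) \<longlonglongrightarrow> (indicator (\<Union>i. F i) x :: complex)" for x
      unfolding eq by (rule LIMSEQ_indicator_UN)
    show "cmod (\<Sum>i<n. indicator (F i) x) \<le> 1" for n x
      unfolding eq by (simp add: indicator_def)
  qed
qed

lemma simple_function_in_closure:
  assumes "simple_function M s"
  shows "(\<lambda>x. s x :: complex) \<in> resolvent_closure M"
proof -
  have fin: "finite (range s)" and meas: "s -` {y} \<in> sets borel" for y
    using assms simple_functionD(2)[OF assms, of "{y}"] by (auto simp: simple_function_def)
  have s_eq: "(\<lambda>x. \<Sum>y\<in>range s. y * indicator (s -` {y}) x) = s"
  proof
    fix x
    have "(\<Sum>y\<in>range s. y * indicator (s -` {y}) x) = (\<Sum>y\<in>range s. if s x = y then y else 0)"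
      by (intro sum.cong) (auto simp: indicator_def)
    then show "(\<Sum>y\<in>range s. y * indicator (s -` {y}) x) = s x" using fin by simp
  qed
  have "(\<lambda>x. \<Sum>y\<in>range s. y * indicator (s -` {y}) x) \<in> resolvent_closure M"
    by (intro resolvent_closure_sum resolvent_closure_scale indicator_in_closure meas)
  then show ?thesis by (simp only: s_eq)
qed

lemma square_integrable_subset_closure:
  assumes "f \<in> square_integrable M"
  shows "f \<in> resolvent_closure M"
proof -
  have "f \<in> borel_measurable M" using assms by (rule square_integrable_measurable)
  from borel_measurable_implies_sequence_metric[OF this, of 0]
  obtain s where s: "\<And>i. simple_function M (s i)" "\<And>x. (\<lambda>i. s i x) \<longlonglongrightarrow> f x"
    "\<And>i x. cmod (s i x) \<le> 2 * cmod (f x)"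
    by auto
  show ?thesis
    by (rule resolvent_closure_dominated[OF simple_function_in_closure[OF s(1)] s(2,3)])
       (use assms in \<open>auto simp: square_integrable_def power_mult_distrib\<close>)
qed

theorem resolvent_span_dense:
  assumes "f \<in> square_integrable M" "0 < e"
  obtains h where "h \<in> resolvent_span" "l2norm M (\<lambda>x. f x - h x) < e"
  using square_integrable_subset_closure[OF assms(1)] assms(2)
  unfolding resolvent_closure_def by blast

end

section \<open>Difference quotients and kernels of resolvents\<close>

lemma resolvent_has_vector_derivative:
  assumes "z \<notin> \<real>"
  shows "((\<lambda>x. 1 / (z - complex_of_real x)) has_vector_derivative
    (1 / (z - complex_of_real x)) * (1 / (z - complex_of_real x))) (at x)"
proof -
  have "((\<lambda>w. 1 / (z - w)) has_field_derivative
      (1 / (z - complex_of_real x)) * (1 / (z - complex_of_real x))) (at (complex_of_real x))"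
    using minus_real_nonzero[OF assms, of x] by (auto intro!: derivative_eq_intros)
  then show ?thesis by (rule has_vector_derivative_real_field)
qed

text \<open>
  The value of the difference quotient on the diagonal is exactly the one for which the product
  formula \<open>e\<^sub>z(x) e\<^sub>z(y)\<close> holds for all \<open>x\<close> and \<open>y\<close>. The constant \<open>k\<close> covers centred functions.
\<close>

lemma diff_quotient_resolvent_sum:
  assumes "finite A" "A \<inter> \<real> = {}"
  shows "diff_quotient (\<lambda>x. resolvent_sum A c x - k) x y =
    (\<Sum>z\<in>A. c z * (1 / (z - complex_of_real x)) * (1 / (z - complex_of_real y)))"
proof (cases "x = y")
  case True
  have "((\<lambda>x. resolvent_sum A c x - k) has_vector_derivative
      (\<Sum>z\<in>A. c z * ((1 / (z - complex_of_real x)) * (1 / (z - complex_of_real x)))) - 0) (at x)"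
    unfolding resolvent_sum_def
    by (intro has_vector_derivative_diff has_vector_derivative_sum has_vector_derivative_const
        has_vector_derivative_mult_right resolvent_has_vector_derivative)
      (use assms in auto)
  from vector_derivative_at[OF this] show ?thesis
    using True by (simp add: diff_quotient_def mult.assoc)
next
  case False
  have "resolvent_sum A c x - k - (resolvent_sum A c y - k)
      = (\<Sum>z\<in>A. c z * (1 / (z - complex_of_real x) - 1 / (z - complex_of_real y)))"
    by (simp only: resolvent_sum_def right_diff_distrib sum_subtractf) simp
  also have "\<dots> = (\<Sum>z\<in>A. c z * (1 / (z - complex_of_real x)) * (1 / (z - complex_of_real y)) * complex_of_real (x - y))"
  proof (rule sum.cong[OF refl])
    fix z assume "z \<in> A"
    then have z: "z \<notin> \<real>" using assms by auto
    have "1 / (z - complex_of_real x) - 1 / (z - complex_of_real y) =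
        (1 / (z - complex_of_real x)) * (1 / (z - complex_of_real y)) * complex_of_real (x - y)"
      using minus_real_nonzero[OF z, of x] minus_real_nonzero[OF z, of y]
      by (simp add: divide_simps)
    then show "c z * (1 / (z - complex_of_real x) - 1 / (z - complex_of_real y)) =
        c z * (1 / (z - complex_of_real x)) * (1 / (z - complex_of_real y)) * complex_of_real (x - y)"
      by (simp only: mult.assoc)
  qed
  finally have "resolvent_sum A c x - k - (resolvent_sum A c y - k) =
      (\<Sum>z\<in>A. c z * (1 / (z - complex_of_real x)) * (1 / (z - complex_of_real y))) * complex_of_real (x - y)"
    by (simp only: sum_distrib_right)
  moreover have "complex_of_real (x - y) \<noteq> 0" using False by simp
  ultimately show ?thesis
    using False by (simp only: diff_quotient_def if_False nonzero_mult_div_cancel_right not_False_eq_True)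
qed

text \<open>
  The bilinear form \<open>\<integral> e\<^sub>z e\<^sub>w dM\<close>; the inner product of \<open>e\<^sub>z\<close> and \<open>e\<^sub>w\<close> is its value at \<open>z\<close> and
  \<open>cnj w\<close>. The bilinear version is the one given by partial fractions.
\<close>

definition resolvent_kernel :: "real measure \<Rightarrow> complex \<Rightarrow> complex \<Rightarrow> complex" where
  "resolvent_kernel M z w = (\<integral>x. (1 / (z - complex_of_real x)) * (1 / (w - complex_of_real x)) \<partial>M)"

lemma cauchy_transform_cnj: "cauchy_transform M (cnj z) = cnj (cauchy_transform M z)"
  unfolding cauchy_transform_def by (subst Bochner_Integration.integral_cnj[symmetric]) simp

context real_distribution
begin

lemma resolvent_integrable: "z \<notin> \<real> \<Longrightarrow> integrable M (\<lambda>x. 1 / (z - complex_of_real x))"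
  by (intro square_integrable_imp_integrable resolvent_square_integrable)

lemma resolvent_product_integrable:
  assumes "z \<notin> \<real>" "w \<notin> \<real>"
  shows "integrable M (\<lambda>x. (1 / (z - complex_of_real x)) * (1 / (w - complex_of_real x)))"
  by (intro integrable_mult_square_integrable resolvent_square_integrable assms)

lemma integral_resolvent_sum:
  assumes "finite A" "A \<inter> \<real> = {}"
  shows "(\<integral>x. resolvent_sum A c x \<partial>M) = (\<Sum>z\<in>A. c z * cauchy_transform M z)"
proof -
  have "(\<integral>x. resolvent_sum A c x \<partial>M) = (\<Sum>z\<in>A. \<integral>x. c z * (1 / (z - complex_of_real x)) \<partial>M)"
    unfolding resolvent_sum_def using assms
    by (intro Bochner_Integration.integral_sum integrable_mult_right resolvent_integrable) auto
  also have "\<dots> = (\<Sum>z\<in>A. c z * cauchy_transform M z)"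
    unfolding cauchy_transform_def by (simp only: integral_mult_right_zero)
  finally show ?thesis .
qed

lemma L_fun_resolvent_sum:
  assumes "finite A" "A \<inter> \<real> = {}"
  shows "L_fun M (\<lambda>x. resolvent_sum A c x - k) = resolvent_sum A (\<lambda>z. c z * cauchy_transform M z)"
proof
  fix x
  have "L_fun M (\<lambda>x. resolvent_sum A c x - k) x
      = (\<integral>y. resolvent_sum A (\<lambda>z. c z * (1 / (z - complex_of_real x))) y \<partial>M)"
    unfolding L_fun_def diff_quotient_resolvent_sum[OF assms] by (simp only: resolvent_sum_def)
  also have "\<dots> = (\<Sum>z\<in>A. c z * (1 / (z - complex_of_real x)) * cauchy_transform M z)"
    by (rule integral_resolvent_sum[OF assms])
  also have "\<dots> = resolvent_sum A (\<lambda>z. c z * cauchy_transform M z) x"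
    unfolding resolvent_sum_def by (intro sum.cong) auto
  finally show "L_fun M (\<lambda>x. resolvent_sum A c x - k) x
      = resolvent_sum A (\<lambda>z. c z * cauchy_transform M z) x" .
qed

text \<open>
  The imaginary part of \<open>e\<^sub>z\<close> has constant sign, opposite to that of \<open>Im z\<close>, and vanishes nowhere.
\<close>

lemma cauchy_transform_nonzero:
  assumes "z \<notin> \<real>"
  shows "cauchy_transform M z \<noteq> 0"
proof
  assume "cauchy_transform M z = 0"
  let ?p = "\<lambda>x. 1 / (cmod (z - complex_of_real x))\<^sup>2"
  have z: "Im z \<noteq> 0" using assms by (simp add: complex_is_Real_iff)
  have Im: "Im (1 / (z - complex_of_real x)) = - Im z * ?p x" for x
    by (simp add: Im_divide cmod_power2)
  have "integrable M (\<lambda>x. Im (1 / (z - complex_of_real x)))"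
    by (rule integrable_Im[OF resolvent_integrable[OF assms]])
  then have int: "integrable M ?p"
    unfolding Im using z integrable_mult_left_iff[of M "- Im z" ?p] by simp
  have "0 = Im (cauchy_transform M z)" using \<open>cauchy_transform M z = 0\<close> by simp
  also have "\<dots> = (\<integral>x. Im (1 / (z - complex_of_real x)) \<partial>M)"
    unfolding cauchy_transform_def by (rule integral_Im[OF resolvent_integrable[OF assms], symmetric])
  also have "\<dots> = - Im z * (\<integral>x. ?p x \<partial>M)"
    unfolding Im by (rule integral_mult_right_zero)
  finally have "(\<integral>x. ?p x \<partial>M) = 0" using z by simp
  then have "AE x in M. ?p x = 0"
    using integral_nonneg_eq_0_iff_AE[OF int] by simp
  then have "AE x in M. False"
  proof eventually_elim
    case (elim x)
    then show ?case using minus_real_nonzero[OF assms, of x] by simp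
  qed
  then show False by simp
qed

lemma resolvent_kernel_off_diagonal:
  assumes "z \<notin> \<real>" "w \<notin> \<real>" "z \<noteq> w"
  shows "resolvent_kernel M z w = (cauchy_transform M z - cauchy_transform M w) / (w - z)"
proof -
  have "(1 / (z - complex_of_real x)) * (1 / (w - complex_of_real x)) =
      (1 / (z - complex_of_real x) - 1 / (w - complex_of_real x)) / (w - z)" for x
    using minus_real_nonzero[OF assms(1), of x] minus_real_nonzero[OF assms(2), of x] assms(3)
    by (simp add: divide_simps)
  then show ?thesis
    unfolding resolvent_kernel_def cauchy_transform_def
    using resolvent_integrable[OF assms(1)] resolvent_integrable[OF assms(2)] by simp
qed

text \<open>
  Keeping the imaginary part of \<open>w n\<close> at least as large as that of \<open>z\<close> gives a uniform bound on
  the resolvents, so dominated convergence applies.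
\<close>

lemma
  assumes z: "z \<notin> \<real>" and lim: "w \<longlonglongrightarrow> z" and Im: "\<And>n. \<bar>Im z\<bar> \<le> \<bar>Im (w n)\<bar>"
  shows cauchy_transform_tendsto: "(\<lambda>n. cauchy_transform M (w n)) \<longlonglongrightarrow> cauchy_transform M z"
    and resolvent_kernel_tendsto: "(\<lambda>n. resolvent_kernel M z (w n)) \<longlonglongrightarrow> resolvent_kernel M z z"
proof -
  have pos: "0 < \<bar>Im z\<bar>" using z by (simp add: complex_is_Real_iff)
  then have w: "w n \<notin> \<real>" for n using Im[of n] by (auto simp: complex_is_Real_iff)
  have bound: "cmod (1 / (w n - complex_of_real x)) \<le> 1 / \<bar>Im z\<bar>" for n x
    by (rule order_trans[OF norm_resolvent_le[OF w]]) (use Im[of n] pos in \<open>simp add: frac_le\<close>)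
  have ptw: "(\<lambda>n. 1 / (w n - complex_of_real x)) \<longlonglongrightarrow> 1 / (z - complex_of_real x)" for x
    using minus_real_nonzero[OF z, of x] by (intro tendsto_intros lim)
  show "(\<lambda>n. cauchy_transform M (w n)) \<longlonglongrightarrow> cauchy_transform M z"
    unfolding cauchy_transform_def
    by (rule integral_dominated_convergence[where w = "\<lambda>_. 1 / \<bar>Im z\<bar>"]) (use bound ptw in auto)
  show "(\<lambda>n. resolvent_kernel M z (w n)) \<longlonglongrightarrow> resolvent_kernel M z z"
    unfolding resolvent_kernel_def
  proof (rule integral_dominated_convergence[where w = "\<lambda>_. (1 / \<bar>Im z\<bar>) * (1 / \<bar>Im z\<bar>)"])
    show "AE x in M. (\<lambda>n. 1 / (z - complex_of_real x) * (1 / (w n - complex_of_real x)))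
        \<longlonglongrightarrow> 1 / (z - complex_of_real x) * (1 / (z - complex_of_real x))"
      by (intro AE_I2 tendsto_mult tendsto_const ptw)
    show "AE x in M. norm (1 / (z - complex_of_real x) * (1 / (w n - complex_of_real x)))
        \<le> (1 / \<bar>Im z\<bar>) * (1 / \<bar>Im z\<bar>)" for n
      unfolding norm_mult
      by (intro AE_I2 mult_mono bound norm_resolvent_le z) (use pos in auto)
  qed auto
qed

lemma l2norm_resolvent_sum:
  assumes "finite A" "A \<inter> \<real> = {}"
  shows "complex_of_real ((l2norm M (resolvent_sum A c))\<^sup>2) =
    (\<Sum>z\<in>A. \<Sum>w\<in>A. c z * cnj (c w) * resolvent_kernel M z (cnj w))"
proof -
  have nonreal: "z \<notin> \<real>" "cnj z \<notin> \<real>" if "z \<in> A" for z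
    using assms that by (auto simp: complex_is_Real_iff)
  have "complex_of_real ((l2norm M (resolvent_sum A c))\<^sup>2)
      = (\<integral>x. complex_of_real ((cmod (resolvent_sum A c x))\<^sup>2) \<partial>M)"
    unfolding l2norm_power2 by (rule integral_complex_of_real[symmetric])
  also have "\<dots> = (\<integral>x. (\<Sum>z\<in>A. \<Sum>w\<in>A. c z * cnj (c w) *
      ((1 / (z - complex_of_real x)) * (1 / (cnj w - complex_of_real x)))) \<partial>M)"
  proof (rule Bochner_Integration.integral_cong[OF refl])
    fix x
    have "complex_of_real ((cmod (resolvent_sum A c x))\<^sup>2)
        = (\<Sum>z\<in>A. c z * (1 / (z - complex_of_real x))) * (\<Sum>w\<in>A. cnj (c w) * (1 / (cnj w - complex_of_real x)))"
      by (subst complex_norm_square) (simp add: resolvent_sum_def)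
    also have "\<dots> = (\<Sum>z\<in>A. \<Sum>w\<in>A. c z * cnj (c w) *
      ((1 / (z - complex_of_real x)) * (1 / (cnj w - complex_of_real x))))"
      unfolding sum_product by (intro sum.cong refl) (simp only: mult_ac)
    finally show "complex_of_real ((cmod (resolvent_sum A c x))\<^sup>2) = \<dots>" .
  qed
  also have "\<dots> = (\<Sum>z\<in>A. \<integral>x. (\<Sum>w\<in>A. c z * cnj (c w) *
      ((1 / (z - complex_of_real x)) * (1 / (cnj w - complex_of_real x)))) \<partial>M)"
    by (intro Bochner_Integration.integral_sum Bochner_Integration.integrable_sum
        integrable_mult_right resolvent_product_integrable nonreal)
  also have "\<dots> = (\<Sum>z\<in>A. \<Sum>w\<in>A. \<integral>x. c z * cnj (c w) *
      ((1 / (z - complex_of_real x)) * (1 / (cnj w - complex_of_real x))) \<partial>M)"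
    by (intro sum.cong refl Bochner_Integration.integral_sum
        integrable_mult_right resolvent_product_integrable nonreal)
  also have "\<dots> = (\<Sum>z\<in>A. \<Sum>w\<in>A. c z * cnj (c w) * resolvent_kernel M z (cnj w))"
    unfolding resolvent_kernel_def by (simp only: integral_mult_right_zero)
  finally show ?thesis .
qed

text \<open>
  The orthogonal splitting of \<open>f\<close> into its centred part and its mean.
\<close>

lemma l2norm_centred:
  assumes f: "f \<in> square_integrable M"
  shows "(l2norm M (centred M f))\<^sup>2 = (l2norm M f)\<^sup>2 - (cmod (\<integral>x. f x \<partial>M))\<^sup>2"
proof -
  define m where "m = (\<integral>x. f x \<partial>M)"
  have f_int: "integrable M f" by (rule square_integrable_imp_integrable[OF f])
  have ff_int: "integrable M (\<lambda>x. f x * cnj (f x))"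
    by (intro integrable_mult_square_integrable square_integrable_cnj f)
  have norm: "complex_of_real ((l2norm M h)\<^sup>2) = (\<integral>x. h x * cnj (h x) \<partial>M)" for h
    unfolding l2norm_power2 complex_norm_square[symmetric] by (rule integral_complex_of_real[symmetric])
  have "complex_of_real ((l2norm M (centred M f))\<^sup>2)
      = (\<integral>x. f x * cnj (f x) - m * cnj (f x) - cnj m * f x + m * cnj m \<partial>M)"
    unfolding norm centred_def m_def[symmetric]
    by (intro Bochner_Integration.integral_cong refl) (simp add: algebra_simps)
  also have "\<dots> = (\<integral>x. f x * cnj (f x) \<partial>M) - m * cnj m - cnj m * m + m * cnj m"
    using f_int ff_int by (simp add: m_def prob_space[unfolded space_eq_univ])
  also have "\<dots> = complex_of_real ((l2norm M f)\<^sup>2) - complex_of_real ((cmod m)\<^sup>2)"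
    unfolding norm complex_norm_square by simp
  finally show ?thesis
    unfolding m_def of_real_diff[symmetric] of_real_eq_iff .
qed

end

section \<open>The isometry between centred resolvents and resolvents\<close>

text \<open>
  Here \<open>\<nu>\<close> arises from \<open>\<mu>\<close> by stripping the first level of the continued fraction of its Cauchy
  transform; \<open>\<alpha>\<close> and \<open>\<beta>\<close> are the first Jacobi coefficients of \<open>\<mu>\<close>.
\<close>

locale jacobi_pair = mu: real_distribution \<mu> + nu: real_distribution \<nu>
  for \<mu> \<nu> :: "real measure" +
  fixes \<alpha> \<beta> :: real
  assumes \<beta>_pos: "0 < \<beta>"
    and F_transform_eq: "\<And>z. z \<notin> \<real> \<Longrightarrow>
      F_transform \<mu> z = z - complex_of_real \<alpha> - complex_of_real \<beta> * cauchy_transform \<nu> z"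
begin

lemma cauchy_transform_nu:
  assumes "z \<notin> \<real>"
  shows "complex_of_real \<beta> * cauchy_transform \<nu> z =
    z - complex_of_real \<alpha> - 1 / cauchy_transform \<mu> z"
  using F_transform_eq[OF assms] by (simp add: F_transform_def algebra_simps)

lemma resolvent_kernel_identity_off_diagonal:
  assumes "z \<notin> \<real>" "w \<notin> \<real>" "z \<noteq> w"
  shows "complex_of_real \<beta> * (cauchy_transform \<mu> z * cauchy_transform \<mu> w) * resolvent_kernel \<nu> z w
    = resolvent_kernel \<mu> z w - cauchy_transform \<mu> z * cauchy_transform \<mu> w"
proof -
  let ?G = "cauchy_transform \<mu>" and ?H = "cauchy_transform \<nu>"
  have nz: "?G z \<noteq> 0" "?G w \<noteq> 0" "w - z \<noteq> 0"
    using assms mu.cauchy_transform_nonzero by auto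
  have "complex_of_real \<beta> * (?G z * ?G w) * resolvent_kernel \<nu> z w
      = ?G z * ?G w * (complex_of_real \<beta> * ?H z - complex_of_real \<beta> * ?H w) / (w - z)"
    unfolding nu.resolvent_kernel_off_diagonal[OF assms] by (simp add: algebra_simps)
  also have "\<dots> = ?G z * ?G w * (z - w - 1 / ?G z + 1 / ?G w) / (w - z)"
    unfolding cauchy_transform_nu[OF assms(1)] cauchy_transform_nu[OF assms(2)] by simp
  also have "?G z * ?G w * (z - w - 1 / ?G z + 1 / ?G w) = (?G z - ?G w) - ?G z * ?G w * (w - z)"
    using nz by (simp add: field_simps)
  also have "\<dots> / (w - z) = (?G z - ?G w) / (w - z) - ?G z * ?G w"
    using nz by (simp add: diff_divide_distrib)
  finally show ?thesis
    unfolding mu.resolvent_kernel_off_diagonal[OF assms] .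
qed

text \<open>
  The diagonal is needed, because \<open>z = cnj w\<close> occurs among the inner products of resolvents. It
  follows by letting \<open>w\<close> approach \<open>z\<close> vertically, away from the real axis.
\<close>

lemma resolvent_kernel_identity:
  assumes z: "z \<notin> \<real>" and w: "w \<notin> \<real>"
  shows "complex_of_real \<beta> * (cauchy_transform \<mu> z * cauchy_transform \<mu> w) * resolvent_kernel \<nu> z w
    = resolvent_kernel \<mu> z w - cauchy_transform \<mu> z * cauchy_transform \<mu> w"
proof (cases "z = w")
  case False
  then show ?thesis by (rule resolvent_kernel_identity_off_diagonal[OF z w])
next
  case True
  (* Vertical displacement away from the axis: never equal to z, with imaginary part
     at least as large in absolute value. *)
  define v where "v n = z + \<i> * complex_of_real (Im z * inverse (real (Suc n)))" for n
  have Im_z: "Im z \<noteq> 0" using z by (simp add: complex_is_Real_iff)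
  have "v \<longlonglongrightarrow> z + \<i> * complex_of_real (Im z * 0)"
    unfolding v_def by (intro tendsto_intros LIMSEQ_inverse_real_of_nat)
  then have v: "v \<longlonglongrightarrow> z" by simp
  have "Im (z + \<i> * complex_of_real (Im z * t)) = Im z * (1 + t)" for t
    by (simp add: distrib_left)
  then have Im_v: "Im (v n) = Im z * (1 + inverse (real (Suc n)))" for n
    unfolding v_def .
  have "\<bar>Im z\<bar> * 1 \<le> \<bar>Im z\<bar> * \<bar>1 + inverse (real (Suc n))\<bar>" for n
    by (intro mult_left_mono) auto
  then have Im: "\<bar>Im z\<bar> \<le> \<bar>Im (v n)\<bar>" for n
    unfolding Im_v abs_mult by simp
  have v_nonreal: "v n \<notin> \<real>" for n
    using Im[of n] Im_z by (auto simp: complex_is_Real_iff)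
  have v_neq: "z \<noteq> v n" for n
    using Im_z by (simp add: v_def del: of_nat_Suc)
  have "(\<lambda>n. complex_of_real \<beta> * (cauchy_transform \<mu> z * cauchy_transform \<mu> (v n)) * resolvent_kernel \<nu> z (v n))
      \<longlonglongrightarrow> complex_of_real \<beta> * (cauchy_transform \<mu> z * cauchy_transform \<mu> z) * resolvent_kernel \<nu> z z"
    by (intro tendsto_intros mu.cauchy_transform_tendsto nu.resolvent_kernel_tendsto z v Im)
  moreover have "(\<lambda>n. resolvent_kernel \<mu> z (v n) - cauchy_transform \<mu> z * cauchy_transform \<mu> (v n))
      \<longlonglongrightarrow> resolvent_kernel \<mu> z z - cauchy_transform \<mu> z * cauchy_transform \<mu> z"
    by (intro tendsto_intros mu.cauchy_transform_tendsto mu.resolvent_kernel_tendsto z v Im)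
  ultimately show ?thesis
    unfolding resolvent_kernel_identity_off_diagonal[OF z v_nonreal v_neq] True[symmetric]
    by (rule LIMSEQ_unique)
qed

text \<open>
  Both squared norms are Hermitian forms in the coefficients \<open>c\<close>, and \<open>resolvent_kernel_identity\<close>
  identifies them entry by entry.
\<close>

lemma L_isometric_on_resolvents:
  assumes A: "finite A" "A \<inter> \<real> = {}"
  shows "\<beta> * (l2norm \<nu> (resolvent_sum A (\<lambda>z. c z * cauchy_transform \<mu> z)))\<^sup>2
    = (l2norm \<mu> (centred \<mu> (resolvent_sum A c)))\<^sup>2"
proof -
  let ?G = "cauchy_transform \<mu>"
  define m where "m = (\<Sum>z\<in>A. c z * ?G z)"
  have mean: "(\<integral>x. resolvent_sum A c x \<partial>\<mu>) = m"
    unfolding m_def by (rule mu.integral_resolvent_sum[OF A])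
  have "complex_of_real (\<beta> * (l2norm \<nu> (resolvent_sum A (\<lambda>z. c z * ?G z)))\<^sup>2)
      = (\<Sum>z\<in>A. \<Sum>w\<in>A. complex_of_real \<beta> *
          (c z * ?G z * cnj (c w * ?G w) * resolvent_kernel \<nu> z (cnj w)))"
    unfolding of_real_mult nu.l2norm_resolvent_sum[OF A] sum_distrib_left ..
  also have "\<dots> = (\<Sum>z\<in>A. \<Sum>w\<in>A. c z * cnj (c w) * resolvent_kernel \<mu> z (cnj w)
      - (c z * ?G z) * cnj (c w * ?G w))"
  proof (intro sum.cong refl)
    fix z w assume "z \<in> A" "w \<in> A"
    then have "z \<notin> \<real>" "cnj w \<notin> \<real>" using A by (auto simp: complex_is_Real_iff)
    note kernel = resolvent_kernel_identity[OF this]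
    have "complex_of_real \<beta> * (c z * ?G z * cnj (c w * ?G w) * resolvent_kernel \<nu> z (cnj w))
        = c z * cnj (c w) * (complex_of_real \<beta> * (?G z * ?G (cnj w)) * resolvent_kernel \<nu> z (cnj w))"
      by (simp add: cauchy_transform_cnj)
    also have "\<dots> = c z * cnj (c w) * (resolvent_kernel \<mu> z (cnj w) - ?G z * ?G (cnj w))"
      by (simp only: kernel)
    also have "\<dots> = c z * cnj (c w) * resolvent_kernel \<mu> z (cnj w) - (c z * ?G z) * cnj (c w * ?G w)"
      by (simp add: cauchy_transform_cnj algebra_simps)
    finally show "complex_of_real \<beta> * (c z * ?G z * cnj (c w * ?G w) * resolvent_kernel \<nu> z (cnj w))
        = c z * cnj (c w) * resolvent_kernel \<mu> z (cnj w) - (c z * ?G z) * cnj (c w * ?G w)" .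
  qed
  also have "\<dots> = complex_of_real ((l2norm \<mu> (resolvent_sum A c))\<^sup>2) - m * cnj m"
    unfolding mu.l2norm_resolvent_sum[OF A] sum_subtractf m_def cnj_sum sum_product ..
  also have "\<dots> = complex_of_real ((l2norm \<mu> (centred \<mu> (resolvent_sum A c)))\<^sup>2)"
    unfolding mu.l2norm_centred[OF mu.resolvent_sum_square_integrable[OF A]] mean
    unfolding of_real_diff complex_norm_square ..
  finally show ?thesis unfolding of_real_eq_iff .
qed

text \<open>
  The constants left over by \<open>x - z\<close> add up to minus the sum of the coefficients, and this is minus
  the mean, since the mean of \<open>F(z) e\<^sub>z\<close> is \<open>F(z) G(z) = 1\<close>.
\<close>

lemma K_fun_resolvent_sum:
  assumes A: "finite A" "A \<inter> \<real> = {}"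
  shows "(\<lambda>x. complex_of_real (x - \<alpha>) * resolvent_sum A c x
      - complex_of_real \<beta> * L_fun \<nu> (resolvent_sum A c) x)
    = centred \<mu> (resolvent_sum A (\<lambda>z. c z * F_transform \<mu> z))"
proof
  fix x
  have "L_fun \<nu> (resolvent_sum A c) = resolvent_sum A (\<lambda>z. c z * cauchy_transform \<nu> z)"
    using nu.L_fun_resolvent_sum[OF A, of c 0] by simp
  then have "complex_of_real (x - \<alpha>) * resolvent_sum A c x
      - complex_of_real \<beta> * L_fun \<nu> (resolvent_sum A c) x
      = (\<Sum>z\<in>A. c z * ((complex_of_real x - complex_of_real \<alpha> - complex_of_real \<beta> * cauchy_transform \<nu> z)
           * (1 / (z - complex_of_real x))))"
    unfolding resolvent_sum_def sum_distrib_left sum_subtractf[symmetric]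
    by (simp only: sum_distrib_left sum_subtractf[symmetric]) (intro sum.cong refl, simp add: algebra_simps diff_divide_distrib)
  also have "\<dots> = (\<Sum>z\<in>A. c z * F_transform \<mu> z * (1 / (z - complex_of_real x)) - c z)"
  proof (intro sum.cong refl)
    fix z assume "z \<in> A"
    then have z: "z \<notin> \<real>" using A by auto
    have eq: "complex_of_real x - complex_of_real \<alpha> - complex_of_real \<beta> * cauchy_transform \<nu> z
        = F_transform \<mu> z - (z - complex_of_real x)"
      unfolding F_transform_eq[OF z] by simp
    show "c z * ((complex_of_real x - complex_of_real \<alpha> - complex_of_real \<beta> * cauchy_transform \<nu> z)
           * (1 / (z - complex_of_real x))) = c z * F_transform \<mu> z * (1 / (z - complex_of_real x)) - c z"
      unfolding eq using minus_real_nonzero[OF z, of x] by (simp add: field_simps)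
  qed
  also have "\<dots> = resolvent_sum A (\<lambda>z. c z * F_transform \<mu> z) x - (\<Sum>z\<in>A. c z)"
    by (simp only: resolvent_sum_def sum_subtractf)
  also have "(\<Sum>z\<in>A. c z) = (\<integral>x. resolvent_sum A (\<lambda>z. c z * F_transform \<mu> z) x \<partial>\<mu>)"
    unfolding mu.integral_resolvent_sum[OF A] using A mu.cauchy_transform_nonzero
    by (intro sum.cong) (auto simp: F_transform_def)
  finally show "complex_of_real (x - \<alpha>) * resolvent_sum A c x
      - complex_of_real \<beta> * L_fun \<nu> (resolvent_sum A c) x
    = centred \<mu> (resolvent_sum A (\<lambda>z. c z * F_transform \<mu> z)) x"
    by (simp only: centred_def)
qed

end

section \<open>The space of classes as a metric space\<close>

lemma equiv_ae_eq: "equiv (square_integrable M) (ae_eq M)"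
proof (rule equivI)
  show "ae_eq M \<subseteq> square_integrable M \<times> square_integrable M"
    by (auto simp: ae_eq_def)
  show "refl_on (square_integrable M) (ae_eq M)"
    by (auto simp: refl_on_def ae_eq_def)
  show "sym (ae_eq M)"
    by (auto simp: sym_def ae_eq_def)
  show "trans (ae_eq M)"
  proof (rule transI)
    fix f g h assume "(f, g) \<in> ae_eq M" "(g, h) \<in> ae_eq M"
    moreover from this have "AE x in M. f x = g x" "AE x in M. g x = h x"
      by (auto simp: ae_eq_def)
    then have "AE x in M. f x = h x" by eventually_elim simp
    ultimately show "(f, h) \<in> ae_eq M" by (auto simp: ae_eq_def)
  qed
qed

lemma L2_class_in_L2: "f \<in> square_integrable M \<Longrightarrow> L2_class M f \<in> L2 M"
  unfolding L2_class_def L2_def by (rule quotientI)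

lemma L2_class_eq_iff:
  assumes "f \<in> square_integrable M" "g \<in> square_integrable M"
  shows "L2_class M f = L2_class M g \<longleftrightarrow> (AE x in M. f x = g x)"
  unfolding L2_class_def eq_equiv_class_iff[OF equiv_ae_eq assms] using assms by (simp add: ae_eq_def)

lemma L2_rep_class:
  assumes f: "f \<in> square_integrable M"
  shows "L2_rep (L2_class M f) \<in> square_integrable M" "AE x in M. L2_rep (L2_class M f) x = f x"
proof -
  have "f \<in> L2_class M f"
    unfolding L2_class_def by (rule equiv_class_self[OF equiv_ae_eq f])
  then have "L2_rep (L2_class M f) \<in> L2_class M f"
    unfolding L2_rep_def by (rule someI[of "\<lambda>g. g \<in> L2_class M f"])
  then have "(f, L2_rep (L2_class M f)) \<in> ae_eq M" by (simp add: L2_class_def)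
  then show "L2_rep (L2_class M f) \<in> square_integrable M" "AE x in M. L2_rep (L2_class M f) x = f x"
    by (auto simp: ae_eq_def elim: eventually_mono)
qed

lemma L2_cases:
  assumes "F \<in> L2 M"
  obtains f where "f \<in> square_integrable M" "F = L2_class M f"
  using assms unfolding L2_def L2_class_def by (rule quotientE)

lemma L2_add_class:
  assumes f: "f \<in> square_integrable M" and g: "g \<in> square_integrable M"
  shows "L2_add M (L2_class M f) (L2_class M g) = L2_class M (\<lambda>x. f x + g x)"
  unfolding L2_add_def
proof (subst L2_class_eq_iff)
  show "AE x in M. L2_rep (L2_class M f) x + L2_rep (L2_class M g) x = f x + g x"
    using L2_rep_class(2)[OF f] L2_rep_class(2)[OF g] by eventually_elim simp
qed (intro square_integrable_add f g L2_rep_class(1))+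

lemma L2_scale_class:
  assumes f: "f \<in> square_integrable M"
  shows "L2_scale M c (L2_class M f) = L2_class M (\<lambda>x. c * f x)"
  unfolding L2_scale_def
proof (subst L2_class_eq_iff)
  show "AE x in M. c * L2_rep (L2_class M f) x = c * f x"
    using L2_rep_class(2)[OF f] by eventually_elim simp
qed (intro square_integrable_scale f L2_rep_class(1))+

lemma L2_scale_scale: "F \<in> L2 M \<Longrightarrow> L2_scale M a (L2_scale M b F) = L2_scale M (a * b) F"
  by (elim L2_cases) (simp add: L2_scale_class square_integrable_scale mult.assoc)

lemma L2_scale_one: "F \<in> L2 M \<Longrightarrow> L2_scale M 1 F = F"
  by (elim L2_cases) (simp add: L2_scale_class)

lemma L2_scale_in: "F \<in> L2 M \<Longrightarrow> L2_scale M c F \<in> L2 M"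
  by (elim L2_cases) (simp add: L2_scale_class square_integrable_scale L2_class_in_L2)

lemma L2_inner_class:
  assumes f: "f \<in> square_integrable M" and g: "g \<in> square_integrable M"
  shows "L2_inner M (L2_class M f) (L2_class M g) = (\<integral>x. f x * cnj (g x) \<partial>M)"
  unfolding L2_inner_def
proof (rule integral_cong_AE)
  show "AE x in M. L2_rep (L2_class M f) x * cnj (L2_rep (L2_class M g) x) = f x * cnj (g x)"
    using L2_rep_class(2)[OF f] L2_rep_class(2)[OF g] by eventually_elim simp
  show "(\<lambda>x. L2_rep (L2_class M f) x * cnj (L2_rep (L2_class M g) x)) \<in> borel_measurable M"
    "(\<lambda>x. f x * cnj (g x)) \<in> borel_measurable M"
    by (intro borel_measurable_integrable integrable_mult_square_integrable square_integrable_cnj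
        L2_rep_class(1) f g)+
qed

lemma L2_dist_class:
  assumes f: "f \<in> square_integrable M" and g: "g \<in> square_integrable M"
  shows "L2_dist M (L2_class M f) (L2_class M g) = l2norm M (\<lambda>x. f x - g x)"
proof -
  have "L2_dist M (L2_class M f) (L2_class M g)
      = l2norm M (\<lambda>x. L2_rep (L2_class M f) x - L2_rep (L2_class M g) x)"
    by (simp add: L2_dist_def l2norm_def)
  also have "\<dots> = l2norm M (\<lambda>x. f x - g x)"
  proof (rule l2norm_cong_AE)
    show "AE x in M. L2_rep (L2_class M f) x - L2_rep (L2_class M g) x = f x - g x"
      using L2_rep_class(2)[OF f] L2_rep_class(2)[OF g] by eventually_elim simp
  qed (intro square_integrable_measurable square_integrable_diff f g L2_rep_class(1))+
  finally show ?thesis .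
qed

lemma Metric_space_L2: "Metric_space (L2 M) (L2_dist M)"
proof
  show "0 \<le> L2_dist M F G" for F G by (simp add: L2_dist_def)
  show "L2_dist M F G = L2_dist M G F" for F G by (simp add: L2_dist_def norm_minus_commute)
  show "L2_dist M F G = 0 \<longleftrightarrow> F = G" if "F \<in> L2 M" "G \<in> L2 M" for F G
  proof -
    obtain f where f: "f \<in> square_integrable M" "F = L2_class M f" by (rule L2_cases[OF \<open>F \<in> L2 M\<close>])
    obtain g where g: "g \<in> square_integrable M" "G = L2_class M g" by (rule L2_cases[OF \<open>G \<in> L2 M\<close>])
    from f g show ?thesis
      by (simp add: L2_dist_class L2_class_eq_iff l2norm_eq_0_iff square_integrable_diff)
  qed
  show "L2_dist M F H \<le> L2_dist M F G + L2_dist M G H"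
    if "F \<in> L2 M" "G \<in> L2 M" "H \<in> L2 M" for F G H
  proof -
    obtain f where f: "f \<in> square_integrable M" "F = L2_class M f" by (rule L2_cases[OF \<open>F \<in> L2 M\<close>])
    obtain g where g: "g \<in> square_integrable M" "G = L2_class M g" by (rule L2_cases[OF \<open>G \<in> L2 M\<close>])
    obtain h where h: "h \<in> square_integrable M" "H = L2_class M h" by (rule L2_cases[OF \<open>H \<in> L2 M\<close>])
    from f g h show ?thesis by (simp add: L2_dist_class l2norm_triangle_diff)
  qed
qed

lemma L2_class_in_zero_mean_iff:
  assumes f: "f \<in> square_integrable M"
  shows "L2_class M f \<in> L2_zero_mean M \<longleftrightarrow> (\<integral>x. f x \<partial>M) = 0"
proof -
  have "(\<integral>x. L2_rep (L2_class M f) x \<partial>M) = (\<integral>x. f x \<partial>M)"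
    by (intro integral_cong_AE square_integrable_measurable L2_rep_class f)
  then show ?thesis using L2_class_in_L2[OF f] by (simp add: L2_zero_mean_def)
qed

section \<open>Extensions by density\<close>

lemma continuous_extension_unique:
  assumes T: "is_continuous_extension X Y R T" and Y: "Hausdorff_space Y"
    and dense: "topspace X \<subseteq> X closure_of (Domain R)"
  shows "continuous_extension X Y R = T"
  unfolding continuous_extension_def
proof (rule the_equality, rule T)
  fix T' assume T': "is_continuous_extension X Y R T'"
  show "T' = T"
  proof (rule extensionalityI[where A = "topspace X"])
    fix x assume "x \<in> topspace X"
    then have "x \<in> X closure_of (Domain R)" using dense by blast
    then show "T' x = T x"
    proof (rule forall_in_closure_of_eq[OF _ Y])
      show "T' F = T F" if "F \<in> Domain R" for F
        using that T T' by (force simp: is_continuous_extension_def)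
    qed (use T T' in \<open>auto simp: is_continuous_extension_def\<close>)
  qed (use T T' in \<open>auto simp: is_continuous_extension_def\<close>)
qed

lemma Lipschitz_imp_continuous_map_mtopology:
  assumes M: "Metric_space M d" and M': "Metric_space M' d'" and "0 < k"
    and maps: "\<And>x. x \<in> M \<Longrightarrow> f x \<in> M'"
    and Lipschitz: "\<And>x y. x \<in> M \<Longrightarrow> y \<in> M \<Longrightarrow> d' (f x) (f y) \<le> k * d x y"
  shows "continuous_map (Metric_space.mtopology M d) (Metric_space.mtopology M' d') f"
  unfolding Metric_space.metric_continuous_map[OF M M']
proof (intro conjI ballI allI impI)
  show "f ` M \<subseteq> M'" using maps by blast
  fix a and e :: real assume "a \<in> M" "0 < e"
  show "\<exists>\<delta>>0. \<forall>x. x \<in> M \<and> d a x < \<delta> \<longrightarrow> d' (f a) (f x) < e"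
  proof (intro exI conjI allI impI)
    show "0 < e / k" using \<open>0 < e\<close> \<open>0 < k\<close> by simp
    fix x assume x: "x \<in> M \<and> d a x < e / k"
    then have "k * d a x < e" using \<open>0 < k\<close> by (simp add: field_simps)
    then show "d' (f a) (f x) < e" using Lipschitz[of a x] \<open>a \<in> M\<close> x by simp
  qed
qed

text \<open>
  Closing the graph at the level of functions, before any choice of classes, keeps the roles of
  the two spaces symmetric: the extensions of an operator and of its inverse come from the same
  closed relation.
\<close>

definition graph_closure :: "real measure \<Rightarrow> real measure \<Rightarrow>
    ((real \<Rightarrow> complex) \<Rightarrow> (real \<Rightarrow> complex) \<Rightarrow> bool) \<Rightarrow> (real \<Rightarrow> complex) \<Rightarrow> (real \<Rightarrow> complex) \<Rightarrow> bool" where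
  "graph_closure M N P f g \<longleftrightarrow> f \<in> square_integrable M \<and> g \<in> square_integrable N \<and>
     (\<forall>e>0. \<exists>f' g'. P f' g' \<and> l2norm M (\<lambda>x. f x - f' x) < e \<and> l2norm N (\<lambda>x. g x - g' x) < e)"

lemma graph_closure_converse: "graph_closure N M (\<lambda>g f. P f g) g f \<longleftrightarrow> graph_closure M N P f g"
  unfolding graph_closure_def by blast

text \<open>
  The bounded linear extension principle: approximants of \<open>f\<close> at a geometric rate have images that
  converge at a geometric rate, by boundedness, and the limit exists by completeness.
\<close>

lemma graph_closure_total:
  assumes N: "real_distribution N" and "0 < k"
    and P: "\<And>f g. P f g \<Longrightarrow> f \<in> square_integrable M \<and> g \<in> square_integrable N"
    and bounded: "\<And>f g f' g'. P f g \<Longrightarrow> P f' g' \<Longrightarrow>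
      l2norm N (\<lambda>x. g x - g' x) \<le> k * l2norm M (\<lambda>x. f x - f' x)"
    and f: "f \<in> square_integrable M"
    and approx: "\<And>e. 0 < e \<Longrightarrow> \<exists>f' g'. P f' g' \<and> l2norm M (\<lambda>x. f x - f' x) < e"
  obtains g where "graph_closure M N P f g"
proof -
  interpret N: real_distribution N by (rule N)
  (* The rate is divided by 2k: two approximants are then within (1/2)^m / k of each other,
     and their images within (1/2)^m. *)
  have "\<forall>n::nat. \<exists>f' g'. P f' g' \<and> l2norm M (\<lambda>x. f x - f' x) < (1/2)^n / (2 * k)"
    using approx \<open>0 < k\<close> by simp
  then obtain u v where uv: "\<And>n. P (u n) (v n)"
    and close: "\<And>n::nat. l2norm M (\<lambda>x. f x - u n x) < (1/2)^n / (2 * k)"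
    by metis
  have u: "u n \<in> square_integrable M" and v: "v n \<in> square_integrable N" for n
    using P[OF uv] by auto
  have Cauchy: "l2norm N (\<lambda>x. v m x - v n x) \<le> (1/2)^m" if "m \<le> n" for m n
  proof -
    have pow: "((1::real)/2)^n \<le> (1/2)^m" using that by (rule power_decreasing) auto
    have "l2norm M (\<lambda>x. u m x - u n x) \<le> l2norm M (\<lambda>x. f x - u m x) + l2norm M (\<lambda>x. f x - u n x)"
      using l2norm_triangle_diff[OF u f u, of m n] l2norm_minus_commute[of M f "u m"] by simp
    also have "\<dots> \<le> (1/2)^m / (2 * k) + (1/2)^n / (2 * k)"
      using close[of m] close[of n] by linarith
    also have "\<dots> \<le> (1/2)^m / (2 * k) + (1/2)^m / (2 * k)"
      using pow \<open>0 < k\<close> by (intro add_left_mono divide_right_mono) auto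
    also have "\<dots> = (1/2)^m / k" using \<open>0 < k\<close> by (simp add: field_simps)
    finally have "k * l2norm M (\<lambda>x. u m x - u n x) \<le> k * ((1/2)^m / k)"
      using \<open>0 < k\<close> by (intro mult_left_mono) auto
    then show ?thesis using bounded[OF uv uv, of m n] \<open>0 < k\<close> by simp
  qed
  obtain g where g: "g \<in> square_integrable N"
    and lim: "\<And>n. l2norm N (\<lambda>x. v n x - g x) \<le> (1/2)^n"
    by (rule N.L2_geometric_Cauchy_converges[where f = v]) (rule v, erule Cauchy, blast)
  have "\<exists>f' g'. P f' g' \<and> l2norm M (\<lambda>x. f x - f' x) < e \<and> l2norm N (\<lambda>x. g x - g' x) < e"
    if "0 < e" for e
  proof -
    define d where "d = min e (e * (2 * k))"
    have "0 < d" using \<open>0 < e\<close> \<open>0 < k\<close> by (simp add: d_def)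
    then obtain n where n: "((1::real)/2)^n < d"
      using real_arch_pow_inv[of d "1/2"] by auto
    have "((1::real)/2)^n < e * (2 * k)" using n by (simp add: d_def)
    then have "((1::real)/2)^n / (2 * k) < e" using \<open>0 < k\<close> by (simp add: divide_less_eq)
    then have "l2norm M (\<lambda>x. f x - u n x) < e" using close[of n] by linarith
    moreover have "l2norm N (\<lambda>x. g x - v n x) < e"
      using lim[of n] n l2norm_minus_commute[of N g "v n"] by (simp add: d_def)
    ultimately show ?thesis using uv by blast
  qed
  then have "graph_closure M N P f g" using f g by (simp add: graph_closure_def)
  then show ?thesis by (rule that)
qed

section \<open>The closed graph of the operator\<close>

context jacobi_pair
begin

text \<open>
  The graph of \<open>L\<^sub>\<mu>\<close> on centred spans of resolvents. By \<open>L_pair_surj_resolvents\<close>, the same relation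
  read backwards is the graph of \<open>x - \<alpha> - \<beta> L\<^sub>\<nu>\<close>.
\<close>

definition L_pair :: "(real \<Rightarrow> complex) \<Rightarrow> (real \<Rightarrow> complex) \<Rightarrow> bool" where
  "L_pair f g \<longleftrightarrow> (\<exists>A c. finite A \<and> A \<inter> \<real> = {} \<and> f = centred \<mu> (resolvent_sum A c) \<and>
     g = resolvent_sum A (\<lambda>z. c z * cauchy_transform \<mu> z))"

lemma L_pair_square_integrable:
  assumes "L_pair f g"
  shows "f \<in> square_integrable \<mu>" "g \<in> square_integrable \<nu>" "(\<integral>x. f x \<partial>\<mu>) = 0"
  using assms unfolding L_pair_def
  by (auto intro: mu.square_integrable_centred mu.resolvent_sum_square_integrable
      nu.resolvent_sum_square_integrable mu.integral_centred)

lemma L_pair_isometric: "L_pair f g \<Longrightarrow> sqrt \<beta> * l2norm \<nu> g = l2norm \<mu> f"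
proof -
  assume "L_pair f g"
  then have "\<beta> * (l2norm \<nu> g)\<^sup>2 = (l2norm \<mu> f)\<^sup>2"
    unfolding L_pair_def using L_isometric_on_resolvents by blast
  then have "(sqrt \<beta> * l2norm \<nu> g)\<^sup>2 = (l2norm \<mu> f)\<^sup>2"
    using \<beta>_pos by (simp add: power_mult_distrib)
  then show ?thesis using \<beta>_pos by simp
qed

lemma L_pair_add:
  assumes "L_pair f g" "L_pair f' g'"
  shows "L_pair (\<lambda>x. f x + k * f' x) (\<lambda>x. g x + k * g' x)"
proof -
  let ?G = "cauchy_transform \<mu>"
  obtain A c B d where A: "finite A" "A \<inter> \<real> = {}" and B: "finite B" "B \<inter> \<real> = {}"
    and f: "f = centred \<mu> (resolvent_sum A c)" "f' = centred \<mu> (resolvent_sum B d)"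
    and g: "g = resolvent_sum A (\<lambda>z. c z * ?G z)" "g' = resolvent_sum B (\<lambda>z. d z * ?G z)"
    using assms unfolding L_pair_def by blast
  let ?h = "\<lambda>z. (if z \<in> A then c z else 0) + k * (if z \<in> B then d z else 0)"
  have int: "integrable \<mu> (resolvent_sum A c)" "integrable \<mu> (resolvent_sum B d)"
    using A B by (auto intro: mu.square_integrable_imp_integrable mu.resolvent_sum_square_integrable)
  have sum: "resolvent_sum (A \<union> B) ?h = (\<lambda>x. resolvent_sum A c x + k * resolvent_sum B d x)"
    using A B by (simp add: resolvent_sum_add)
  have "(\<lambda>x. f x + k * f' x) = centred \<mu> (resolvent_sum (A \<union> B) ?h)"
    unfolding sum f centred_def using int by (simp add: algebra_simps)
  moreover have "(\<lambda>x. g x + k * g' x) = resolvent_sum (A \<union> B) (\<lambda>z. ?h z * ?G z)"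
  proof
    fix x
    show "g x + k * g' x = resolvent_sum (A \<union> B) (\<lambda>z. ?h z * ?G z) x"
      unfolding g resolvent_sum_add[OF A(1) B(1)] unfolding resolvent_sum_def
      by (intro sum.cong) (auto simp: algebra_simps)
  qed
  ultimately show ?thesis
    unfolding L_pair_def using A B by (intro exI[of _ "A \<union> B"] exI[of _ ?h]) auto
qed

lemma L_pair_diff:
  assumes "L_pair f g" "L_pair f' g'"
  shows "L_pair (\<lambda>x. f x - f' x) (\<lambda>x. g x - g' x)"
  using L_pair_add[OF assms, of "-1"] by simp

text \<open>
  Centring does not increase the norm, so centring an approximant of a centred function does not
  spoil the approximation.
\<close>

lemma L_pair_domain_dense:
  assumes f: "f \<in> square_integrable \<mu>" and mean: "(\<integral>x. f x \<partial>\<mu>) = 0" and "0 < e"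
  shows "\<exists>f' g'. L_pair f' g' \<and> l2norm \<mu> (\<lambda>x. f x - f' x) < e"
proof -
  obtain h where h: "h \<in> resolvent_span" "l2norm \<mu> (\<lambda>x. f x - h x) < e"
    using mu.resolvent_span_dense[OF f \<open>0 < e\<close>] .
  then obtain A c where A: "finite A" "A \<inter> \<real> = {}" "h = resolvent_sum A c"
    unfolding resolvent_span_iff by blast
  have hS: "h \<in> square_integrable \<mu>" using h(1) by (rule mu.resolvent_span_square_integrable)
  have "(\<lambda>x. f x - centred \<mu> h x) = centred \<mu> (\<lambda>x. f x - h x)"
    unfolding centred_def
    using mean mu.square_integrable_imp_integrable[OF f] mu.square_integrable_imp_integrable[OF hS]
    by (simp add: fun_eq_iff)
  moreover have "(l2norm \<mu> (centred \<mu> (\<lambda>x. f x - h x)))\<^sup>2 \<le> (l2norm \<mu> (\<lambda>x. f x - h x))\<^sup>2"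
    unfolding mu.l2norm_centred[OF square_integrable_diff[OF f hS]] by simp
  then have "l2norm \<mu> (centred \<mu> (\<lambda>x. f x - h x)) \<le> l2norm \<mu> (\<lambda>x. f x - h x)"
    by (rule power2_le_imp_le) simp
  ultimately have "l2norm \<mu> (\<lambda>x. f x - centred \<mu> h x) < e" using h by simp
  then show ?thesis using A unfolding L_pair_def by blast
qed

text \<open>
  The coefficients are multiplied by \<open>F\<close>, which \<open>L\<^sub>\<mu>\<close> cancels through the factor \<open>G\<close>.
\<close>

lemma L_pair_surj_resolvents:
  assumes A: "finite A" "A \<inter> \<real> = {}"
  shows "L_pair (centred \<mu> (resolvent_sum A (\<lambda>z. c z * F_transform \<mu> z))) (resolvent_sum A c)"
proof -
  have "resolvent_sum A c = resolvent_sum A (\<lambda>z. c z * F_transform \<mu> z * cauchy_transform \<mu> z)"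
    unfolding resolvent_sum_def F_transform_def using A mu.cauchy_transform_nonzero
    by (intro ext sum.cong) auto
  then show ?thesis using A unfolding L_pair_def by blast
qed

lemma L_pair_range_dense:
  assumes g: "g \<in> square_integrable \<nu>" and "0 < e"
  shows "\<exists>g' f'. L_pair f' g' \<and> l2norm \<nu> (\<lambda>x. g x - g' x) < e"
proof -
  obtain h where h: "h \<in> resolvent_span" "l2norm \<nu> (\<lambda>x. g x - h x) < e"
    using nu.resolvent_span_dense[OF assms] .
  then show ?thesis
    unfolding resolvent_span_iff using L_pair_surj_resolvents by blast
qed

definition L_rel :: "(real \<Rightarrow> complex) \<Rightarrow> (real \<Rightarrow> complex) \<Rightarrow> bool" where
  "L_rel = graph_closure \<mu> \<nu> L_pair"

lemma L_rel_square_integrable: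
  assumes "L_rel f g" shows "f \<in> square_integrable \<mu>" "g \<in> square_integrable \<nu>"
  using assms by (simp_all add: L_rel_def graph_closure_def)

lemma L_relE:
  assumes "L_rel f g" "0 < e"
  obtains f' g' where "L_pair f' g'" "l2norm \<mu> (\<lambda>x. f x - f' x) < e" "l2norm \<nu> (\<lambda>x. g x - g' x) < e"
  using assms by (auto simp: L_rel_def graph_closure_def)

lemma L_pair_imp_L_rel: "L_pair f g \<Longrightarrow> L_rel f g"
  using L_pair_square_integrable by (force simp: L_rel_def graph_closure_def l2norm_def)

lemma L_rel_mean:
  assumes "L_rel f g" shows "(\<integral>x. f x \<partial>\<mu>) = 0"
proof (rule ccontr)
  assume "(\<integral>x. f x \<partial>\<mu>) \<noteq> 0"
  then have "0 < cmod (\<integral>x. f x \<partial>\<mu>)" by simp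
  then obtain f' g' where fg: "L_pair f' g'" "l2norm \<mu> (\<lambda>x. f x - f' x) < cmod (\<integral>x. f x \<partial>\<mu>)"
    by (rule L_relE[OF assms])
  note S = L_rel_square_integrable(1)[OF assms] L_pair_square_integrable(1)[OF fg(1)]
  have "cmod (\<integral>x. f x - f' x \<partial>\<mu>) \<le> l2norm \<mu> (\<lambda>x. f x - f' x)"
    by (intro mu.norm_integral_le_l2norm square_integrable_diff S)
  then show False
    using fg(2) L_pair_square_integrable(3)[OF fg(1)] S[THEN mu.square_integrable_imp_integrable]
    by simp
qed

text \<open>
  The identity for \<open>L_pair\<close> passes to the closure by continuity of the norms: approximation within
  \<open>e\<close> moves the two sides by less than \<open>e + \<surd>\<beta> e\<close> in total, which is contradictory for the
  \<open>e\<close> chosen below.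
\<close>

lemma L_rel_isometric:
  assumes "L_rel f g" shows "sqrt \<beta> * l2norm \<nu> g = l2norm \<mu> f"
proof (rule ccontr)
  define e where "e = \<bar>sqrt \<beta> * l2norm \<nu> g - l2norm \<mu> f\<bar> / (1 + sqrt \<beta>)"
  have pos: "0 < 1 + sqrt \<beta>" using \<beta>_pos by (simp add: add_pos_nonneg)
  assume "sqrt \<beta> * l2norm \<nu> g \<noteq> l2norm \<mu> f"
  then have "0 < e" using pos by (simp add: e_def)
  then obtain f' g' where fg: "L_pair f' g'" "l2norm \<mu> (\<lambda>x. f x - f' x) < e" "l2norm \<nu> (\<lambda>x. g x - g' x) < e"
    by (rule L_relE[OF assms])
  have f: "\<bar>l2norm \<mu> f - l2norm \<mu> f'\<bar> < e"
    using l2norm_triangle_sub[OF L_rel_square_integrable(1)[OF assms] L_pair_square_integrable(1)[OF fg(1)]] fg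
    by simp
  have "\<bar>l2norm \<nu> g - l2norm \<nu> g'\<bar> < e"
    using l2norm_triangle_sub[OF L_rel_square_integrable(2)[OF assms] L_pair_square_integrable(2)[OF fg(1)]] fg
    by simp
  then have "sqrt \<beta> * \<bar>l2norm \<nu> g - l2norm \<nu> g'\<bar> < sqrt \<beta> * e" using \<beta>_pos by simp
  then have g: "\<bar>sqrt \<beta> * l2norm \<nu> g - sqrt \<beta> * l2norm \<nu> g'\<bar> < sqrt \<beta> * e"
    using \<beta>_pos by (simp add: abs_mult flip: right_diff_distrib)
  have "\<bar>sqrt \<beta> * l2norm \<nu> g - l2norm \<mu> f\<bar> < e + sqrt \<beta> * e"
    using f g L_pair_isometric[OF fg(1)] by linarith
  also have "\<dots> = (1 + sqrt \<beta>) * e" by (simp add: distrib_right)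
  also have "\<dots> = \<bar>sqrt \<beta> * l2norm \<nu> g - l2norm \<mu> f\<bar>" using pos by (simp add: e_def)
  finally show False by simp
qed

lemma L_rel_add:
  assumes fg: "L_rel f g" and fg': "L_rel f' g'"
  shows "L_rel (\<lambda>x. f x + k * f' x) (\<lambda>x. g x + k * g' x)"
proof -
  note S = L_rel_square_integrable[OF fg] L_rel_square_integrable[OF fg']
  have "\<exists>u v. L_pair u v \<and> l2norm \<mu> (\<lambda>x. f x + k * f' x - u x) < e \<and> l2norm \<nu> (\<lambda>x. g x + k * g' x - v x) < e"
    if "0 < e" for e
  proof -
    define d where "d = e / (1 + cmod k)"
    have k: "0 < 1 + cmod k" by (simp add: add_pos_nonneg)
    have "0 < d" using \<open>0 < e\<close> k by (simp add: d_def)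
    obtain u v where uv: "L_pair u v" "l2norm \<mu> (\<lambda>x. f x - u x) < d" "l2norm \<nu> (\<lambda>x. g x - v x) < d"
      using L_relE[OF fg \<open>0 < d\<close>] .
    obtain u' v' where uv': "L_pair u' v'" "l2norm \<mu> (\<lambda>x. f' x - u' x) < d" "l2norm \<nu> (\<lambda>x. g' x - v' x) < d"
      using L_relE[OF fg' \<open>0 < d\<close>] .
    note Suv = L_pair_square_integrable[OF uv(1)] L_pair_square_integrable[OF uv'(1)]
    have est: "l2norm M (\<lambda>x. h x + k * h' x - (w x + k * w' x)) < e"
      if "h \<in> square_integrable M" "h' \<in> square_integrable M" "w \<in> square_integrable M" "w' \<in> square_integrable M"
        and "l2norm M (\<lambda>x. h x - w x) < d" "l2norm M (\<lambda>x. h' x - w' x) < d" for M h h' w w'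
    proof -
      have "l2norm M (\<lambda>x. h x + k * h' x - (w x + k * w' x)) = l2norm M (\<lambda>x. (h x - w x) + k * (h' x - w' x))"
        by (simp add: algebra_simps)
      also have "\<dots> \<le> l2norm M (\<lambda>x. h x - w x) + l2norm M (\<lambda>x. k * (h' x - w' x))"
        by (intro l2norm_triangle square_integrable_scale square_integrable_diff that)
      also have "\<dots> < d + cmod k * d"
        unfolding l2norm_scale using that(5,6) by (intro add_less_le_mono mult_left_mono) auto
      also have "\<dots> = (1 + cmod k) * d" by (simp add: distrib_right)
      also have "\<dots> = e" unfolding d_def using k by (subst times_divide_eq_right, subst nonzero_mult_div_cancel_left) auto
      finally show ?thesis .
    qed
    show ?thesis
      using L_pair_add[OF uv(1) uv'(1), of k]
        est[OF S(1,3) Suv(1,4) uv(2) uv'(2)] est[OF S(2,4) Suv(2,5) uv(3) uv'(3)] by blast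
  qed
  then show ?thesis
    using S unfolding L_rel_def graph_closure_def
    by (intro conjI square_integrable_add square_integrable_scale) auto
qed

lemma L_rel_diff:
  assumes "L_rel f g" "L_rel f' g'"
  shows "L_rel (\<lambda>x. f x - f' x) (\<lambda>x. g x - g' x)"
  using L_rel_add[OF assms, of "-1"] by simp

lemma L_rel_dist:
  assumes "L_rel f g" "L_rel f' g'"
  shows "sqrt \<beta> * l2norm \<nu> (\<lambda>x. g x - g' x) = l2norm \<mu> (\<lambda>x. f x - f' x)"
  by (rule L_rel_isometric[OF L_rel_diff[OF assms]])

lemma L_rel_AE_iff:
  assumes "L_rel f g" "L_rel f' g'"
  shows "(AE x in \<mu>. f x = f' x) \<longleftrightarrow> (AE x in \<nu>. g x = g' x)"
proof -
  note S = L_rel_square_integrable[OF L_rel_diff[OF assms]]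
  have "(AE x in \<mu>. f x - f' x = 0) \<longleftrightarrow> (AE x in \<nu>. g x - g' x = 0)"
    unfolding l2norm_eq_0_iff[OF S(1), symmetric] l2norm_eq_0_iff[OF S(2), symmetric]
      L_rel_dist[OF assms, symmetric] using \<beta>_pos by simp
  then show ?thesis by simp
qed

lemma L_rel_class_eq_iff:
  assumes "L_rel f g" "L_rel f' g'"
  shows "L2_class \<mu> f = L2_class \<mu> f' \<longleftrightarrow> L2_class \<nu> g = L2_class \<nu> g'"
  using L_rel_AE_iff[OF assms] L_rel_square_integrable[OF assms(1)] L_rel_square_integrable[OF assms(2)]
  by (simp add: L2_class_eq_iff)

lemma L_rel_inner:
  assumes "L_rel f g" "L_rel f' g'"
  shows "complex_of_real \<beta> * (\<integral>x. g x * cnj (g' x) \<partial>\<nu>) = (\<integral>x. f x * cnj (f' x) \<partial>\<mu>)"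
proof -
  have "complex_of_real ((l2norm \<mu> (\<lambda>x. f x + k * f' x))\<^sup>2)
      = complex_of_real \<beta> * complex_of_real ((l2norm \<nu> (\<lambda>x. g x + k * g' x))\<^sup>2)" for k
    unfolding L_rel_isometric[OF L_rel_add[OF assms], symmetric]
    using \<beta>_pos by (simp add: power_mult_distrib flip: of_real_power)
  note norm = this
  show ?thesis
    unfolding l2norm_polarization[OF L_rel_square_integrable(1)[OF assms(1)] L_rel_square_integrable(1)[OF assms(2)]]
      l2norm_polarization[OF L_rel_square_integrable(2)[OF assms(1)] L_rel_square_integrable(2)[OF assms(2)]] norm
    by (simp add: algebra_simps)
qed

lemma L_rel_total:
  assumes f: "f \<in> square_integrable \<mu>" "(\<integral>x. f x \<partial>\<mu>) = 0"
  obtains g where "L_rel f g"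
proof (rule graph_closure_total[where P = L_pair and M = \<mu> and N = \<nu> and f = f and k = "1 / sqrt \<beta>"])
  show "l2norm \<nu> (\<lambda>x. g x - g' x) \<le> 1 / sqrt \<beta> * l2norm \<mu> (\<lambda>x. f x - f' x)"
    if "L_pair f g" "L_pair f' g'" for f g f' g'
    using L_pair_isometric[OF L_pair_diff[OF that]] \<beta>_pos by (simp add: field_simps)
next
  show "\<exists>f' g'. L_pair f' g' \<and> l2norm \<mu> (\<lambda>x. f x - f' x) < e" if "0 < e" for e
    by (rule L_pair_domain_dense[OF f that])
qed (use f \<beta>_pos that in \<open>auto simp: L_rel_def nu.real_distribution_axioms
    intro: L_pair_square_integrable\<close>)

lemma L_rel_surj:
  assumes g: "g \<in> square_integrable \<nu>"
  obtains f where "L_rel f g"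
proof (rule graph_closure_total[where P = "\<lambda>g f. L_pair f g" and M = \<nu> and N = \<mu> and f = g and k = "sqrt \<beta>"])
  show "l2norm \<mu> (\<lambda>x. f x - f' x) \<le> sqrt \<beta> * l2norm \<nu> (\<lambda>x. g x - g' x)"
    if "L_pair f g" "L_pair f' g'" for f g f' g'
    using L_pair_isometric[OF L_pair_diff[OF that]] by simp
  show thesis if "graph_closure \<nu> \<mu> (\<lambda>g f. L_pair f g) g f" for f
  proof -
    have "L_rel f g" unfolding L_rel_def using that by (rule graph_closure_converse[THEN iffD1])
    then show thesis by (rule \<open>\<And>f. L_rel f g \<Longrightarrow> thesis\<close>)
  qed
next
  show "\<exists>g' f'. L_pair f' g' \<and> l2norm \<nu> (\<lambda>x. g x - g' x) < e" if "0 < e" for e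
    by (rule L_pair_range_dense[OF g that])
qed (use g \<beta>_pos in \<open>auto simp: mu.real_distribution_axioms
    intro: L_pair_square_integrable\<close>)

lemma L_rel_zero: "L_rel (\<lambda>x. 0) (\<lambda>x. 0)"
proof -
  have "(\<lambda>x. 0) \<in> square_integrable \<mu>" by (rule mu.square_integrable_const)
  then obtain g where "L_rel (\<lambda>x. 0) g" using L_rel_total[of "\<lambda>x. 0"] by auto
  from L_rel_diff[OF this this] show ?thesis by simp
qed

lemma L_rel_scale: "L_rel f g \<Longrightarrow> L_rel (\<lambda>x. k * f x) (\<lambda>x. k * g x)"
  using L_rel_add[OF L_rel_zero, of f g k] by simp

section \<open>The two operators on classes\<close>

definition L_map :: "(real \<Rightarrow> complex) set \<Rightarrow> (real \<Rightarrow> complex) set" where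
  "L_map = restrict (\<lambda>F. THE G. \<exists>f g. L_rel f g \<and> F = L2_class \<mu> f \<and> G = L2_class \<nu> g) (L2_zero_mean \<mu>)"

definition K_map :: "(real \<Rightarrow> complex) set \<Rightarrow> (real \<Rightarrow> complex) set" where
  "K_map = restrict (\<lambda>G. THE F. \<exists>f g. L_rel f g \<and> F = L2_class \<mu> f \<and> G = L2_class \<nu> g) (L2 \<nu>)"

lemma L_rel_class_in:
  assumes "L_rel f g"
  shows "L2_class \<mu> f \<in> L2_zero_mean \<mu>" "L2_class \<nu> g \<in> L2 \<nu>"
  using L_rel_square_integrable[OF assms] L_rel_mean[OF assms]
  by (auto simp: L2_class_in_zero_mean_iff L2_class_in_L2)

lemma L_map_class:
  assumes "L_rel f g" shows "L_map (L2_class \<mu> f) = L2_class \<nu> g"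
proof -
  have "(THE G. \<exists>f' g'. L_rel f' g' \<and> L2_class \<mu> f = L2_class \<mu> f' \<and> G = L2_class \<nu> g') = L2_class \<nu> g"
  proof (rule the_equality)
    show "\<exists>f' g'. L_rel f' g' \<and> L2_class \<mu> f = L2_class \<mu> f' \<and> L2_class \<nu> g = L2_class \<nu> g'"
      using assms by blast
    show "G = L2_class \<nu> g"
      if "\<exists>f' g'. L_rel f' g' \<and> L2_class \<mu> f = L2_class \<mu> f' \<and> G = L2_class \<nu> g'" for G
      using that L_rel_class_eq_iff[OF assms] by metis
  qed
  then show ?thesis using L_rel_class_in(1)[OF assms] by (simp add: L_map_def)
qed

lemma K_map_class:
  assumes "L_rel f g" shows "K_map (L2_class \<nu> g) = L2_class \<mu> f"
proof -
  have "(THE F. \<exists>f' g'. L_rel f' g' \<and> F = L2_class \<mu> f' \<and> L2_class \<nu> g = L2_class \<nu> g') = L2_class \<mu> f"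
  proof (rule the_equality)
    show "\<exists>f' g'. L_rel f' g' \<and> L2_class \<mu> f = L2_class \<mu> f' \<and> L2_class \<nu> g = L2_class \<nu> g'"
      using assms by blast
    show "F = L2_class \<mu> f"
      if "\<exists>f' g'. L_rel f' g' \<and> F = L2_class \<mu> f' \<and> L2_class \<nu> g = L2_class \<nu> g'" for F
      using that L_rel_class_eq_iff[OF assms] by metis
  qed
  then show ?thesis using L_rel_class_in(2)[OF assms] by (simp add: K_map_def)
qed

lemma zero_mean_cases:
  assumes "F \<in> L2_zero_mean \<mu>"
  obtains f g where "L_rel f g" "F = L2_class \<mu> f"
proof -
  have "F \<in> L2 \<mu>" using assms by (simp add: L2_zero_mean_def)
  then obtain f where f: "f \<in> square_integrable \<mu>" "F = L2_class \<mu> f" by (rule L2_cases)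
  then have "(\<integral>x. f x \<partial>\<mu>) = 0" using assms by (simp add: L2_class_in_zero_mean_iff)
  then obtain g where "L_rel f g" using L_rel_total f(1) by blast
  then show ?thesis using f(2) by (rule that)
qed

lemma L2_nu_cases:
  assumes "G \<in> L2 \<nu>"
  obtains f g where "L_rel f g" "G = L2_class \<nu> g"
proof -
  obtain g where g: "g \<in> square_integrable \<nu>" "G = L2_class \<nu> g" using assms by (rule L2_cases)
  then obtain f where "L_rel f g" using L_rel_surj by blast
  then show ?thesis using g(2) by (rule that)
qed

lemma K_map_L_map: "F \<in> L2_zero_mean \<mu> \<Longrightarrow> K_map (L_map F) = F"
  by (elim zero_mean_cases) (simp add: L_map_class K_map_class)

lemma L_map_K_map: "G \<in> L2 \<nu> \<Longrightarrow> L_map (K_map G) = G"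
  by (elim L2_nu_cases) (simp add: L_map_class K_map_class)

lemma L_map_in: "F \<in> L2_zero_mean \<mu> \<Longrightarrow> L_map F \<in> L2 \<nu>"
  by (elim zero_mean_cases) (simp add: L_map_class L_rel_class_in)

lemma K_map_in: "G \<in> L2 \<nu> \<Longrightarrow> K_map G \<in> L2_zero_mean \<mu>"
  by (elim L2_nu_cases) (simp add: K_map_class L_rel_class_in)

lemma L2_dist_L_rel:
  assumes "L_rel f g" "L_rel f' g'"
  shows "sqrt \<beta> * L2_dist \<nu> (L2_class \<nu> g) (L2_class \<nu> g') = L2_dist \<mu> (L2_class \<mu> f) (L2_class \<mu> f')"
  using L_rel_dist[OF assms] L_rel_square_integrable[OF assms(1)] L_rel_square_integrable[OF assms(2)]
  by (simp add: L2_dist_class)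

lemma zero_mean_Submetric: "Submetric (L2 \<mu>) (L2_dist \<mu>) (L2_zero_mean \<mu>)"
  by (simp add: Submetric_def Submetric_axioms_def Metric_space_L2)
     (auto simp: L2_zero_mean_def)

lemma zero_mean_topology:
  "subtopology (L2_topology \<mu>) (L2_zero_mean \<mu>) = Metric_space.mtopology (L2_zero_mean \<mu>) (L2_dist \<mu>)"
  unfolding L2_topology_def by (rule Submetric.mtopology_submetric[OF zero_mean_Submetric, symmetric])

lemma Metric_space_zero_mean: "Metric_space (L2_zero_mean \<mu>) (L2_dist \<mu>)"
  by (rule Metric_space.subspace[OF Metric_space_L2]) (auto simp: L2_zero_mean_def)

lemma L_graph_pairs: "L_graph \<mu> \<nu> = {(L2_class \<mu> f, L2_class \<nu> g) | f g. L_pair f g}"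
proof -
  have "L_fun \<mu> (centred \<mu> (resolvent_sum A c)) = resolvent_sum A (\<lambda>z. c z * cauchy_transform \<mu> z)"
    if "finite A" "A \<inter> \<real> = {}" for A c
    unfolding centred_def by (rule mu.L_fun_resolvent_sum[OF that])
  then show ?thesis
    unfolding L_graph_def L_pair_def resolvent_span_iff by (auto; metis)
qed

lemma K_graph_pairs:
  "(G, F) \<in> K_graph \<mu> \<nu> \<alpha> \<beta> \<longleftrightarrow> (\<exists>A c. finite A \<and> A \<inter> \<real> = {} \<and> G = L2_class \<nu> (resolvent_sum A c) \<and>
     F = L2_class \<mu> (centred \<mu> (resolvent_sum A (\<lambda>z. c z * F_transform \<mu> z))))"
proof -
  have "(G, F) \<in> K_graph \<mu> \<nu> \<alpha> \<beta> \<longleftrightarrow> (\<exists>A c. finite A \<and> A \<inter> \<real> = {} \<and> G = L2_class \<nu> (resolvent_sum A c) \<and>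
      F = L2_class \<mu> (\<lambda>x. complex_of_real (x - \<alpha>) * resolvent_sum A c x
        - complex_of_real \<beta> * L_fun \<nu> (resolvent_sum A c) x))"
    unfolding K_graph_def resolvent_span_iff by blast
  also have "\<dots> \<longleftrightarrow> (\<exists>A c. finite A \<and> A \<inter> \<real> = {} \<and> G = L2_class \<nu> (resolvent_sum A c) \<and>
     F = L2_class \<mu> (centred \<mu> (resolvent_sum A (\<lambda>z. c z * F_transform \<mu> z))))"
    by (intro ex_cong1 conj_cong refl) (simp only: K_fun_resolvent_sum)
  finally show ?thesis .
qed

lemma L_map_extension:
  "is_continuous_extension (subtopology (L2_topology \<mu>) (L2_zero_mean \<mu>)) (L2_topology \<nu>) (L_graph \<mu> \<nu>) L_map"
  unfolding is_continuous_extension_def zero_mean_topology Metric_space.topspace_mtopology[OF Metric_space_zero_mean]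
proof (intro conjI)
  show "L_map \<in> extensional (L2_zero_mean \<mu>)" by (simp add: L_map_def)
  show "\<forall>(F, G)\<in>L_graph \<mu> \<nu>. L_map F = G"
    unfolding L_graph_pairs using L_map_class L_pair_imp_L_rel by blast
  show "continuous_map (Metric_space.mtopology (L2_zero_mean \<mu>) (L2_dist \<mu>)) (L2_topology \<nu>) L_map"
    unfolding L2_topology_def
  proof (rule Lipschitz_imp_continuous_map_mtopology[OF Metric_space_zero_mean Metric_space_L2, where k = "1 / sqrt \<beta>"])
    fix F F' assume F: "F \<in> L2_zero_mean \<mu>" and F': "F' \<in> L2_zero_mean \<mu>"
    obtain f g where fg: "L_rel f g" "F = L2_class \<mu> f" using F by (rule zero_mean_cases)
    obtain f' g' where fg': "L_rel f' g'" "F' = L2_class \<mu> f'" using F' by (rule zero_mean_cases)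
    show "L2_dist \<nu> (L_map F) (L_map F') \<le> 1 / sqrt \<beta> * L2_dist \<mu> F F'"
      unfolding fg(2) fg'(2) L_map_class[OF fg(1)] L_map_class[OF fg'(1)]
        L2_dist_L_rel[OF fg(1) fg'(1), symmetric] using \<beta>_pos by simp
  qed (use \<beta>_pos L_map_in in auto)
qed

lemma K_map_extension:
  "is_continuous_extension (L2_topology \<nu>) (L2_topology \<mu>) (K_graph \<mu> \<nu> \<alpha> \<beta>) K_map"
  unfolding is_continuous_extension_def L2_topology_def Metric_space.topspace_mtopology[OF Metric_space_L2]
proof (intro conjI)
  show "K_map \<in> extensional (L2 \<nu>)" by (simp add: K_map_def)
  show "\<forall>(G, F)\<in>K_graph \<mu> \<nu> \<alpha> \<beta>. K_map G = F"
    using K_map_class[OF L_pair_imp_L_rel[OF L_pair_surj_resolvents]] by (auto simp: K_graph_pairs)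
  show "continuous_map (Metric_space.mtopology (L2 \<nu>) (L2_dist \<nu>)) (Metric_space.mtopology (L2 \<mu>) (L2_dist \<mu>)) K_map"
  proof (rule Lipschitz_imp_continuous_map_mtopology[OF Metric_space_L2 Metric_space_L2, where k = "sqrt \<beta>"])
    fix G G' assume G: "G \<in> L2 \<nu>" and G': "G' \<in> L2 \<nu>"
    obtain f g where fg: "L_rel f g" "G = L2_class \<nu> g" using G by (rule L2_nu_cases)
    obtain f' g' where fg': "L_rel f' g'" "G' = L2_class \<nu> g'" using G' by (rule L2_nu_cases)
    show "L2_dist \<mu> (K_map G) (K_map G') \<le> sqrt \<beta> * L2_dist \<nu> G G'"
      unfolding fg(2) fg'(2) K_map_class[OF fg(1)] K_map_class[OF fg'(1)]
        L2_dist_L_rel[OF fg(1) fg'(1)] by simp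
  next
    show "K_map G \<in> L2 \<mu>" if "G \<in> L2 \<nu>" for G
      using K_map_in[OF that] by (simp add: L2_zero_mean_def)
  qed (use \<beta>_pos in simp)
qed

text \<open>
  The description as the unique extension identifies \<open>L_op\<close> with \<open>L_map\<close>, because the centred
  resolvents are dense among the centred classes.
\<close>

lemma L_op_eq: "L_op \<mu> \<nu> = L_map"
  unfolding L_op_def
proof (rule continuous_extension_unique[OF L_map_extension])
  show "Hausdorff_space (L2_topology \<nu>)"
    unfolding L2_topology_def by (rule Metric_space.Hausdorff_space_mtopology[OF Metric_space_L2])
  show "topspace (subtopology (L2_topology \<mu>) (L2_zero_mean \<mu>))
      \<subseteq> subtopology (L2_topology \<mu>) (L2_zero_mean \<mu>) closure_of Domain (L_graph \<mu> \<nu>)"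
    unfolding zero_mean_topology Metric_space.metric_closure_of[OF Metric_space_zero_mean]
      Metric_space.topspace_mtopology[OF Metric_space_zero_mean]
  proof (intro subsetI CollectI conjI allI impI)
    fix F and r :: real assume F: "F \<in> L2_zero_mean \<mu>" and "0 < r"
    then obtain f g where fg: "L_rel f g" "F = L2_class \<mu> f" by (blast elim: zero_mean_cases)
    obtain f' g' where fg': "L_pair f' g'" "l2norm \<mu> (\<lambda>x. f x - f' x) < r"
      using L_relE[OF fg(1) \<open>0 < r\<close>] .
    have "L2_class \<mu> f' \<in> Metric_space.mball (L2_zero_mean \<mu>) (L2_dist \<mu>) F r"
      unfolding Metric_space.in_mball[OF Metric_space_zero_mean] fg(2)
      using fg' L_rel_class_in(1)[OF fg(1)] L_rel_class_in(1)[OF L_pair_imp_L_rel[OF fg'(1)]]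
        L_rel_square_integrable(1)[OF fg(1)] L_pair_square_integrable(1)[OF fg'(1)]
      by (simp add: L2_dist_class)
    moreover have "L2_class \<mu> f' \<in> Domain (L_graph \<mu> \<nu>)"
      unfolding L_graph_pairs using fg'(1) by blast
    ultimately show "\<exists>y\<in>Domain (L_graph \<mu> \<nu>). y \<in> Metric_space.mball (L2_zero_mean \<mu>) (L2_dist \<mu>) F r"
      by blast
  qed
qed

lemma K_op_eq: "K_op \<mu> \<nu> \<alpha> \<beta> = K_map"
  unfolding K_op_def
proof (rule continuous_extension_unique[OF K_map_extension])
  show "Hausdorff_space (L2_topology \<mu>)"
    unfolding L2_topology_def by (rule Metric_space.Hausdorff_space_mtopology[OF Metric_space_L2])
  show "topspace (L2_topology \<nu>) \<subseteq> L2_topology \<nu> closure_of Domain (K_graph \<mu> \<nu> \<alpha> \<beta>)"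
    unfolding L2_topology_def Metric_space.metric_closure_of[OF Metric_space_L2]
      Metric_space.topspace_mtopology[OF Metric_space_L2]
  proof (intro subsetI CollectI conjI allI impI)
    fix G and r :: real assume "G \<in> L2 \<nu>" and "0 < r"
    then obtain g where g: "g \<in> square_integrable \<nu>" "G = L2_class \<nu> g" by (blast elim: L2_cases)
    obtain h where h: "h \<in> resolvent_span" "l2norm \<nu> (\<lambda>x. g x - h x) < r"
      using nu.resolvent_span_dense[OF g(1) \<open>0 < r\<close>] .
    have "L2_class \<nu> h \<in> Metric_space.mball (L2 \<nu>) (L2_dist \<nu>) G r"
      unfolding Metric_space.in_mball[OF Metric_space_L2] g(2)
      using h g(1) nu.resolvent_span_square_integrable[OF h(1)] by (simp add: L2_dist_class L2_class_in_L2)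
    moreover have "L2_class \<nu> h \<in> Domain (K_graph \<mu> \<nu> \<alpha> \<beta>)"
      unfolding K_graph_def using h(1) by blast
    ultimately show "\<exists>y\<in>Domain (K_graph \<mu> \<nu> \<alpha> \<beta>). y \<in> Metric_space.mball (L2 \<nu>) (L2_dist \<nu>) G r"
      by blast
  qed
qed

text \<open>
  The unitary factor is \<open>\<surd>\<beta> L\<^sub>\<mu>\<close>.
\<close>

lemma L_map_multiple_of_unitary:
  "is_multiple_of_unitary \<mu> (L2_zero_mean \<mu>) \<nu> (L2 \<nu>) L_map"
proof -
  let ?s = "complex_of_real (sqrt \<beta>)"
  let ?U = "\<lambda>F. L2_scale \<nu> ?s (L_map F)"
  have s: "?s \<noteq> 0" using \<beta>_pos by simp
  have ss: "?s * cnj ?s = complex_of_real \<beta>"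
    using \<beta>_pos by (simp flip: of_real_mult)
  have U: "?U (L2_class \<mu> f) = L2_class \<nu> (\<lambda>x. ?s * g x)" if "L_rel f g" for f g
    using that by (simp add: L_map_class L2_scale_class L_rel_square_integrable)
  have bij: "bij_betw ?U (L2_zero_mean \<mu>) (L2 \<nu>)"
  proof (rule bij_betw_byWitness[where f' = "\<lambda>G. K_map (L2_scale \<nu> (1 / ?s) G)"])
    show "\<forall>F\<in>L2_zero_mean \<mu>. K_map (L2_scale \<nu> (1 / ?s) (?U F)) = F"
      using s by (simp add: L2_scale_scale L_map_in L2_scale_one K_map_L_map)
    show "\<forall>G\<in>L2 \<nu>. ?U (K_map (L2_scale \<nu> (1 / ?s) G)) = G"
      using s by (simp add: L_map_K_map L2_scale_in L2_scale_scale L2_scale_one)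
    show "?U ` L2_zero_mean \<mu> \<subseteq> L2 \<nu>" by (auto intro: L2_scale_in L_map_in)
    show "(\<lambda>G. K_map (L2_scale \<nu> (1 / ?s) G)) ` L2 \<nu> \<subseteq> L2_zero_mean \<mu>"
      by (auto intro: L2_scale_in K_map_in)
  qed
  have add: "?U (L2_add \<mu> F F') = L2_add \<nu> (?U F) (?U F')"
    if "F \<in> L2_zero_mean \<mu>" "F' \<in> L2_zero_mean \<mu>" for F F'
  proof -
    obtain f g where fg: "L_rel f g" "F = L2_class \<mu> f" by (rule zero_mean_cases[OF \<open>F \<in> L2_zero_mean \<mu>\<close>])
    obtain f' g' where fg': "L_rel f' g'" "F' = L2_class \<mu> f'" by (rule zero_mean_cases[OF \<open>F' \<in> L2_zero_mean \<mu>\<close>])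
    note S = L_rel_square_integrable[OF fg(1)] L_rel_square_integrable[OF fg'(1)]
    have "?U (L2_add \<mu> F F') = L2_class \<nu> (\<lambda>x. ?s * (g x + g' x))"
      using U[OF L_rel_add[OF fg(1) fg'(1), of 1]] fg fg' S by (simp add: L2_add_class)
    also have "\<dots> = L2_add \<nu> (?U F) (?U F')"
      unfolding fg(2) fg'(2) U[OF fg(1)] U[OF fg'(1)] using S
      by (simp add: L2_add_class square_integrable_scale distrib_left)
    finally show ?thesis .
  qed
  have scale: "?U (L2_scale \<mu> c F) = L2_scale \<nu> c (?U F)" if "F \<in> L2_zero_mean \<mu>" for c F
  proof -
    obtain f g where fg: "L_rel f g" "F = L2_class \<mu> f" by (rule zero_mean_cases[OF \<open>F \<in> L2_zero_mean \<mu>\<close>])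
    note S = L_rel_square_integrable[OF fg(1)]
    have "?U (L2_scale \<mu> c F) = L2_class \<nu> (\<lambda>x. ?s * (c * g x))"
      using U[OF L_rel_scale[OF fg(1), of c]] fg S by (simp add: L2_scale_class)
    also have "\<dots> = L2_scale \<nu> c (?U F)"
      unfolding fg(2) U[OF fg(1)] using S
      by (simp add: L2_scale_class square_integrable_scale mult.left_commute)
    finally show ?thesis .
  qed
  have inner: "L2_inner \<nu> (?U F) (?U F') = L2_inner \<mu> F F'"
    if "F \<in> L2_zero_mean \<mu>" "F' \<in> L2_zero_mean \<mu>" for F F'
  proof -
    obtain f g where fg: "L_rel f g" "F = L2_class \<mu> f" by (rule zero_mean_cases[OF \<open>F \<in> L2_zero_mean \<mu>\<close>])
    obtain f' g' where fg': "L_rel f' g'" "F' = L2_class \<mu> f'" by (rule zero_mean_cases[OF \<open>F' \<in> L2_zero_mean \<mu>\<close>])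
    note S = L_rel_square_integrable[OF fg(1)] L_rel_square_integrable[OF fg'(1)]
    have "L2_inner \<nu> (?U F) (?U F') = (\<integral>x. ?s * g x * cnj (?s * g' x) \<partial>\<nu>)"
      unfolding fg(2) fg'(2) U[OF fg(1)] U[OF fg'(1)]
      by (intro L2_inner_class square_integrable_scale S)
    also have "\<dots> = (\<integral>x. ?s * cnj ?s * (g x * cnj (g' x)) \<partial>\<nu>)"
      by (simp only: complex_cnj_mult mult_ac)
    also have "\<dots> = complex_of_real \<beta> * (\<integral>x. g x * cnj (g' x) \<partial>\<nu>)"
      unfolding ss by (rule integral_mult_right_zero)
    also have "\<dots> = L2_inner \<mu> F F'"
      unfolding fg(2) fg'(2) L2_inner_class[OF S(1,3)] by (rule L_rel_inner[OF fg(1) fg'(1)])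
    finally show ?thesis .
  qed
  have "is_unitary \<mu> (L2_zero_mean \<mu>) \<nu> (L2 \<nu>) ?U"
    unfolding is_unitary_def using bij add scale inner by blast
  moreover have "\<forall>F\<in>L2_zero_mean \<mu>. L_map F = L2_scale \<nu> (1 / ?s) (?U F)"
    using s by (simp add: L2_scale_scale L_map_in L2_scale_one)
  ultimately show ?thesis
    unfolding is_multiple_of_unitary_def using s by (intro exI[of _ "1 / ?s"] exI[of _ ?U]) simp
qed

end

theorem proposition17:
  fixes \<mu> \<nu> :: "real measure" and \<alpha> \<beta> :: real
  assumes "real_distribution \<mu>"
    and "integrable \<mu> (\<lambda>x. x)" and "integrable \<mu> (\<lambda>x. x\<^sup>2)"
    and "mean \<mu> = \<alpha>" and "var \<mu> = \<beta>" and "\<beta> > 0"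
    and "is_J \<mu> \<nu>"
  shows "is_continuous_extension (subtopology (L2_topology \<mu>) (L2_zero_mean \<mu>)) (L2_topology \<nu>)
           (L_graph \<mu> \<nu>) (L_op \<mu> \<nu>)
       \<and> is_continuous_extension (L2_topology \<nu>) (L2_topology \<mu>)
           (K_graph \<mu> \<nu> \<alpha> \<beta>) (K_op \<mu> \<nu> \<alpha> \<beta>)
       \<and> is_multiple_of_unitary \<mu> (L2_zero_mean \<mu>) \<nu> (L2 \<nu>) (L_op \<mu> \<nu>)
       \<and> (\<forall>F\<in>L2_zero_mean \<mu>. K_op \<mu> \<nu> \<alpha> \<beta> (L_op \<mu> \<nu> F) = F)
       \<and> (\<forall>G\<in>L2 \<nu>. K_op \<mu> \<nu> \<alpha> \<beta> G \<in> L2_zero_mean \<mu>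
                     \<and> L_op \<mu> \<nu> (K_op \<mu> \<nu> \<alpha> \<beta> G) = G)"
proof -
  interpret jacobi_pair \<mu> \<nu> \<alpha> \<beta>
    using assms by (simp add: jacobi_pair_def jacobi_pair_axioms_def is_J_def)
  show ?thesis
    unfolding L_op_eq K_op_eq
    using L_map_extension K_map_extension L_map_multiple_of_unitary K_map_L_map K_map_in L_map_K_map
    by blast
qed

end
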